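(* Let $S$ be a second countable abelian locally compact Hausdorff group bundle. There is a one-to-one correspondence between the isomorphism classes of principal $S$-bundles and the elements of the sheaf cohomology group $H^1(S)$. Given a principal $S$-bundle $X$ with trivialization $(\mathcal{U},\phi,\gamma)$, the cohomology class in $H^1(S)$ associated to $X$ is the one realized by the cocycle $\gamma$.
   Context: A (groupoid) group bundle is a locally compact Hausdorff groupoid $S$ whose range and source maps coincide; the common map is denoted $p:S\to S^{(0)}$, and the fibres $S_u=p^{-1}(u)$ are groups. $S$ is abelian if every $S_u$ is abelian. For open $U\subset S^{(0)}$ put $S|_U=p^{-1}(U)$; $U_{ij}=U_i\cap U_j$. Principal $S$-bundle with trivialization $(\mathcal U,\phi,\gamma)$: a locally compact Hausdorff space $X$ with a continuous surjection $q:X\to S^{(0)}$, an open cover $\mathcal{U}=\{U_i\}_{i\in I}$ of $S^{(0)}$, homeomorphisms $\phi_i:q^{-1}(U_i)\to p^{-1}(U_i)$ with $p\circ\phi_i=q$, and (continuous) sections $\gamma_{ij}:U_{ij}\to S$ of $p$ such that $\phi_i\circ\phi_j^{-1}(s)=\gamma_{ij}(p(s))s$ for all $s\in S|_{U_{ij}}$. Isomorphism: if $q:X\to S^{(0)}$ and $r:Y\to S^{(0)}$ are principal $S$-bundles with trivializations $(\mathcal U,\phi,\gamma)$ and $(\mathcal V,\psi,\eta)$, an isomorphism $(\mathcal W,\Omega,\beta)$ consists of a common refinement $\mathcal W=\{W_i\}$ of $\mathcal U$ and $\mathcal V$ with refining maps $\rho$, $\sigma$ respectively, a homeomorphism $\Omega:X\to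 Y$ with $r\circ\Omega=q$, and sections $\beta_i:W_i\to S$ of $p$ with $\psi_{\sigma(i)}\circ\Omega\circ\phi_{\rho(i)}^{-1}(s)=\beta_i(p(s))s$ for all $s\in p^{-1}(W_i)$. Two trivializations of the same $X$ are equivalent if the identity map is an isomorphism between them; a principal $S$-bundle is such an $X$ equipped with a maximal collection of pairwise equivalent trivializations. $H^n(S):=H^n(S^{(0)};\mathcal S)$ is the (Čech-type) sheaf cohomology of the abelian sheaf $\mathcal{S}(U)=\Gamma(U,S)$ of continuous sections of $p$ over open $U\subset S^{(0)}$, under pointwise multiplication. In particular $H^1(S)$ is the direct limit over open covers $\mathcal U$ of $Z^1(\mathcal U,\mathcal S)/B^1(\mathcal U,\mathcal S)$, where a cocycle is a family $\gamma_{ij}\in\mathcal S(U_{ij})$ with $\gamma_{ij}\gamma_{jk}=\gamma_{ik}$ on $U_i\cap U_j\cap U_k$, and a boundary is a family of the form $\beta_i\beta_j^{-1}|_{U_{ij}}$ with $\beta_i\in\mathcal S(U_i)$. *)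

theory Defs
  imports "HOL-Analysis.Analysis" "HOL-Algebra.Product_Groups"
begin

section \<open>Locally compact Hausdorff groupoids and group bundles\<close>

record 's groupoid =
  gtop :: "'s topology"
  gcomp :: "('s \<times> 's) set"
  gmult :: "'s \<Rightarrow> 's \<Rightarrow> 's"
  ginv :: "'s \<Rightarrow> 's"

abbreviation gset :: "'s groupoid \<Rightarrow> 's set" where
  "gset S \<equiv> topspace (gtop S)"

text \<open>The algebraic axioms are those of Hahn and Renault: \<open>gcomp\<close> is the set of composable
  pairs, and units, range and source are derived notions.\<close>

definition groupoid :: "'s groupoid \<Rightarrow> bool" where
  "groupoid S \<longleftrightarrow>
     gcomp S \<subseteq> gset S \<times> gset S \<and>
     (\<forall>(x, y) \<in> gcomp S. gmult S x y \<in> gset S) \<and>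
     (\<forall>x \<in> gset S. ginv S x \<in> gset S \<and> ginv S (ginv S x) = x) \<and>
     (\<forall>x y z. (x, y) \<in> gcomp S \<and> (y, z) \<in> gcomp S \<longrightarrow>
        (gmult S x y, z) \<in> gcomp S \<and> (x, gmult S y z) \<in> gcomp S \<and>
        gmult S (gmult S x y) z = gmult S x (gmult S y z)) \<and>
     (\<forall>x \<in> gset S. (ginv S x, x) \<in> gcomp S \<and> (x, ginv S x) \<in> gcomp S) \<and>
     (\<forall>(x, y) \<in> gcomp S.
        gmult S (ginv S x) (gmult S x y) = y \<and> gmult S (gmult S x y) (ginv S y) = x)"

definition grange :: "'s groupoid \<Rightarrow> 's \<Rightarrow> 's" where
  "grange S x = gmult S x (ginv S x)"

definition gsource :: "'s groupoid \<Rightarrow> 's \<Rightarrow> 's" where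
  "gsource S x = gmult S (ginv S x) x"

definition lch_groupoid :: "'s groupoid \<Rightarrow> bool" where
  "lch_groupoid S \<longleftrightarrow>
     groupoid S \<and>
     locally_compact_space (gtop S) \<and> Hausdorff_space (gtop S) \<and>
     continuous_map (subtopology (prod_topology (gtop S) (gtop S)) (gcomp S)) (gtop S)
       (\<lambda>(x, y). gmult S x y) \<and>
     continuous_map (gtop S) (gtop S) (ginv S)"

definition group_bundle :: "'s groupoid \<Rightarrow> bool" where
  "group_bundle S \<longleftrightarrow> lch_groupoid S \<and> (\<forall>x \<in> gset S. grange S x = gsource S x)"

text \<open>For a group bundle the range map is the bundle projection \<open>p\<close>; the unit space
  \<open>S\<^sup>(\<^sup>0\<^sup>)\<close> is a subspace of \<open>S\<close>.\<close>

abbreviation gproj :: "'s groupoid \<Rightarrow> 's \<Rightarrow> 's" where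
  "gproj S \<equiv> grange S"

definition gunits :: "'s groupoid \<Rightarrow> 's set" where
  "gunits S = gproj S ` gset S"

definition unit_top :: "'s groupoid \<Rightarrow> 's topology" where
  "unit_top S = subtopology (gtop S) (gunits S)"

definition grestr :: "'s groupoid \<Rightarrow> 's set \<Rightarrow> 's set" where
  "grestr S U = {s \<in> gset S. gproj S s \<in> U}"

definition fibre :: "'s groupoid \<Rightarrow> 's \<Rightarrow> 's monoid" where
  "fibre S u = \<lparr>carrier = {s \<in> gset S. gproj S s = u}, mult = gmult S, one = u\<rparr>"

definition abelian_bundle :: "'s groupoid \<Rightarrow> bool" where
  "abelian_bundle S \<longleftrightarrow> group_bundle S \<and> (\<forall>u \<in> gunits S. comm_group (fibre S u))"


section \<open>The sheaf of sections and its Cech cohomology in degree one\<close>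

definition sections :: "'s groupoid \<Rightarrow> 's set \<Rightarrow> ('s \<Rightarrow> 's) monoid" where
  "sections S U = \<lparr>
     carrier = {f \<in> extensional U.
       continuous_map (subtopology (unit_top S) U) (gtop S) f \<and> (\<forall>u \<in> U. gproj S (f u) = u)},
     mult = (\<lambda>f g. \<lambda>u\<in>U. gmult S (f u) (g u)),
     one = (\<lambda>u\<in>U. u)\<rparr>"

text \<open>A cover is a family \<open>(U\<^sub>i)\<close> for \<open>i\<close> in an index set \<open>I\<close>, given as the pair \<open>(I, U)\<close>.\<close>

type_synonym ('i, 's) cover = "'i set \<times> ('i \<Rightarrow> 's set)"

definition open_cover :: "'s groupoid \<Rightarrow> ('i, 's) cover \<Rightarrow> bool" where
  "open_cover S = (\<lambda>(I, U). (\<forall>i\<in>I. openin (unit_top S) (U i)) \<and> (\<Union>i\<in>I. U i) = gunits S)"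

definition refines_via :: "('i, 's) cover \<Rightarrow> ('i \<Rightarrow> 'i) \<Rightarrow> ('i, 's) cover \<Rightarrow> bool" where
  "refines_via = (\<lambda>(K, W) \<rho> (I, U). \<rho> \<in> K \<rightarrow> I \<and> (\<forall>k\<in>K. W k \<subseteq> U (\<rho> k)))"

definition cochains0 :: "'s groupoid \<Rightarrow> ('i, 's) cover \<Rightarrow> ('i \<Rightarrow> 's \<Rightarrow> 's) monoid" where
  "cochains0 S = (\<lambda>(I, U). product_group I (\<lambda>i. sections S (U i)))"

definition cochains1 :: "'s groupoid \<Rightarrow> ('i, 's) cover \<Rightarrow> ('i \<times> 'i \<Rightarrow> 's \<Rightarrow> 's) monoid" where
  "cochains1 S = (\<lambda>(I, U). product_group (I \<times> I) (\<lambda>(i, j). sections S (U i \<inter> U j)))"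

definition cocycles :: "'s groupoid \<Rightarrow> ('i, 's) cover \<Rightarrow> ('i \<times> 'i \<Rightarrow> 's \<Rightarrow> 's) monoid" where
  "cocycles S = (\<lambda>(I, U). (cochains1 S (I, U))\<lparr>carrier :=
     {\<gamma> \<in> carrier (cochains1 S (I, U)).
        \<forall>i\<in>I. \<forall>j\<in>I. \<forall>k\<in>I. \<forall>u \<in> U i \<inter> U j \<inter> U k.
          gmult S (\<gamma> (i, j) u) (\<gamma> (j, k) u) = \<gamma> (i, k) u}\<rparr>)"

definition coboundary ::
    "'s groupoid \<Rightarrow> ('i, 's) cover \<Rightarrow> ('i \<Rightarrow> 's \<Rightarrow> 's) \<Rightarrow> 'i \<times> 'i \<Rightarrow> 's \<Rightarrow> 's" where
  "coboundary S = (\<lambda>(I, U) \<beta>. \<lambda>(i, j)\<in>I \<times> I. \<lambda>u \<in> U i \<inter> U j. gmult S (\<beta> i u) (ginv S (\<beta> j u)))"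

definition boundaries :: "'s groupoid \<Rightarrow> ('i, 's) cover \<Rightarrow> ('i \<times> 'i \<Rightarrow> 's \<Rightarrow> 's) set" where
  "boundaries S U = coboundary S U ` carrier (cochains0 S U)"

definition cech_H1 :: "'s groupoid \<Rightarrow> ('i, 's) cover \<Rightarrow> ('i \<times> 'i \<Rightarrow> 's \<Rightarrow> 's) set monoid" where
  "cech_H1 S U = cocycles S U Mod boundaries S U"

definition pull_cochain ::
    "('i, 's) cover \<Rightarrow> ('i \<Rightarrow> 'i) \<Rightarrow> ('i \<times> 'i \<Rightarrow> 's \<Rightarrow> 's) \<Rightarrow> 'i \<times> 'i \<Rightarrow> 's \<Rightarrow> 's" where
  "pull_cochain = (\<lambda>(K, W) \<rho> \<gamma>. \<lambda>(k, l)\<in>K \<times> K. \<lambda>u \<in> W k \<inter> W l. \<gamma> (\<rho> k, \<rho> l) u)"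

text \<open>The map induced on cosets: \<open>B\<^sup>1(U) \<gamma> \<mapsto> B\<^sup>1(W) (\<rho>\<^sup>* \<gamma>)\<close>.\<close>

definition pull_class ::
    "'s groupoid \<Rightarrow> ('i, 's) cover \<Rightarrow> ('i \<Rightarrow> 'i) \<Rightarrow> ('i \<times> 'i \<Rightarrow> 's \<Rightarrow> 's) set \<Rightarrow>
      ('i \<times> 'i \<Rightarrow> 's \<Rightarrow> 's) set" where
  "pull_class S W \<rho> c = boundaries S W <#>\<^bsub>cocycles S W\<^esub> (pull_cochain W \<rho> ` c)"

text \<open>\<open>sheaf_H1\<close> is the direct limit of the groups \<open>cech_H1 S U\<close> over all open covers \<open>U\<close>
  with indices in the type \<open>'i\<close>. This is the full limit over open covers as soon as
  every set of open subsets of the unit space can be indexed by elements of \<open>'i\<close>.\<close>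

type_synonym ('i, 's) local_class = "('i, 's) cover \<times> ('i \<times> 'i \<Rightarrow> 's \<Rightarrow> 's) set"

definition local_classes :: "'s groupoid \<Rightarrow> ('i, 's) local_class set" where
  "local_classes S = (SIGMA U : {U. open_cover S U}. carrier (cech_H1 S U))"

definition limit_rel :: "'s groupoid \<Rightarrow> (('i, 's) local_class \<times> ('i, 's) local_class) set" where
  "limit_rel S = {((U, c), (V, d)).
     (U, c) \<in> local_classes S \<and> (V, d) \<in> local_classes S \<and>
     (\<exists>W \<rho> \<sigma>. open_cover S W \<and> refines_via W \<rho> U \<and> refines_via W \<sigma> V \<and>
        pull_class S W \<rho> c = pull_class S W \<sigma> d)}"

definition sheaf_H1 :: "'s groupoid \<Rightarrow> ('i, 's) local_class set monoid" where
  "sheaf_H1 S = \<lparr>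
     carrier = local_classes S // limit_rel S,
     mult = (\<lambda>a b. \<Union>{limit_rel S `` {(U, c \<otimes>\<^bsub>cech_H1 S U\<^esub> d)} | U c d. (U, c) \<in> a \<and> (U, d) \<in> b}),
     one = \<Union>{limit_rel S `` {(U, \<one>\<^bsub>cech_H1 S U\<^esub>)} | U. open_cover S U}\<rparr>"

definition cocycle_class ::
    "'s groupoid \<Rightarrow> ('i, 's) cover \<Rightarrow> ('i \<times> 'i \<Rightarrow> 's \<Rightarrow> 's) \<Rightarrow> ('i, 's) local_class set" where
  "cocycle_class S U \<gamma> = limit_rel S `` {(U, boundaries S U #>\<^bsub>cocycles S U\<^esub> \<gamma>)}"


section \<open>Principal bundles\<close>

definition preim :: "'x topology \<Rightarrow> ('x \<Rightarrow> 's) \<Rightarrow> 's set \<Rightarrow> 'x set" where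
  "preim X q U = {x \<in> topspace X. q x \<in> U}"

definition lch_space_over :: "'s groupoid \<Rightarrow> 'x topology \<Rightarrow> ('x \<Rightarrow> 's) \<Rightarrow> bool" where
  "lch_space_over S X q \<longleftrightarrow>
     locally_compact_space X \<and> Hausdorff_space X \<and>
     continuous_map X (unit_top S) q \<and> q ` topspace X = gunits S"

type_synonym ('i, 'x, 's) trivialization =
  "('i, 's) cover \<times> ('i \<Rightarrow> 'x \<Rightarrow> 's) \<times> ('i \<times> 'i \<Rightarrow> 's \<Rightarrow> 's)"

definition is_trivialization ::
    "'s groupoid \<Rightarrow> 'x topology \<Rightarrow> ('x \<Rightarrow> 's) \<Rightarrow> ('i, 'x, 's) trivialization \<Rightarrow> bool" where
  "is_trivialization S X q = (\<lambda>((I, U), \<phi>, \<gamma>).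
     open_cover S (I, U) \<and>
     (\<forall>i\<in>I. homeomorphic_map (subtopology X (preim X q (U i)))
                (subtopology (gtop S) (grestr S (U i))) (\<phi> i) \<and>
        (\<forall>x \<in> preim X q (U i). gproj S (\<phi> i x) = q x)) \<and>
     \<gamma> \<in> carrier (cochains1 S (I, U)) \<and>
     (\<forall>i\<in>I. \<forall>j\<in>I. \<forall>s \<in> grestr S (U i \<inter> U j).
        \<phi> i (inv_into (preim X q (U j)) (\<phi> j) s) = gmult S (\<gamma> (i, j) (gproj S s)) s))"

text \<open>\<open>is_iso S (X, q, T) (Y, r, T') (W, \<rho>, \<sigma>, \<Omega>, \<beta>)\<close>: the triple \<open>(W, \<Omega>, \<beta>)\<close>, with refining
  maps \<open>\<rho>\<close> and \<open>\<sigma>\<close>, is an isomorphism from \<open>X\<close> with trivialization \<open>T\<close> to \<open>Y\<close> with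
  trivialization \<open>T'\<close>.\<close>

definition is_iso ::
    "'s groupoid \<Rightarrow> 'x topology \<times> ('x \<Rightarrow> 's) \<times> ('i, 'x, 's) trivialization \<Rightarrow>
      'y topology \<times> ('y \<Rightarrow> 's) \<times> ('i, 'y, 's) trivialization \<Rightarrow>
      ('i, 's) cover \<times> ('i \<Rightarrow> 'i) \<times> ('i \<Rightarrow> 'i) \<times> ('x \<Rightarrow> 'y) \<times> ('i \<Rightarrow> 's \<Rightarrow> 's) \<Rightarrow> bool" where
  "is_iso S = (\<lambda>(X, q, (I, U), \<phi>, \<gamma>) (Y, r, (J, V), \<psi>, \<eta>) ((K, W), \<rho>, \<sigma>, \<Omega>, \<beta>).
     open_cover S (K, W) \<and> refines_via (K, W) \<rho> (I, U) \<and> refines_via (K, W) \<sigma> (J, V) \<and>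
     homeomorphic_map X Y \<Omega> \<and> (\<forall>x \<in> topspace X. r (\<Omega> x) = q x) \<and>
     \<beta> \<in> carrier (cochains0 S (K, W)) \<and>
     (\<forall>k\<in>K. \<forall>s \<in> grestr S (W k).
        \<psi> (\<sigma> k) (\<Omega> (inv_into (preim X q (U (\<rho> k))) (\<phi> (\<rho> k)) s)) =
          gmult S (\<beta> k (gproj S s)) s))"

definition equiv_triv ::
    "'s groupoid \<Rightarrow> 'x topology \<Rightarrow> ('x \<Rightarrow> 's) \<Rightarrow>
      ('i, 'x, 's) trivialization \<Rightarrow> ('i, 'x, 's) trivialization \<Rightarrow> bool" where
  "equiv_triv S X q T T' \<longleftrightarrow> (\<exists>W \<rho> \<sigma> \<beta>. is_iso S (X, q, T) (X, q, T') (W, \<rho>, \<sigma>, id, \<beta>))"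

definition compatible_trivs ::
    "'s groupoid \<Rightarrow> 'x topology \<Rightarrow> ('x \<Rightarrow> 's) \<Rightarrow> ('i, 'x, 's) trivialization set \<Rightarrow> bool" where
  "compatible_trivs S X q A \<longleftrightarrow>
     (\<forall>T\<in>A. is_trivialization S X q T) \<and> (\<forall>T\<in>A. \<forall>T'\<in>A. equiv_triv S X q T T')"

record ('i, 'x, 's) pbundle =
  btop :: "'x topology"
  bproj :: "'x \<Rightarrow> 's"
  btrivs :: "('i, 'x, 's) trivialization set"

definition principal_bundle :: "'s groupoid \<Rightarrow> ('i, 'x, 's) pbundle \<Rightarrow> bool" where
  "principal_bundle S P \<longleftrightarrow>
     lch_space_over S (btop P) (bproj P) \<and>
     btrivs P \<noteq> {} \<and>
     compatible_trivs S (btop P) (bproj P) (btrivs P) \<and>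
     (\<forall>A. compatible_trivs S (btop P) (bproj P) A \<and> btrivs P \<subseteq> A \<longrightarrow> A = btrivs P)"

definition isomorphic_bundles ::
    "'s groupoid \<Rightarrow> ('i, 'x, 's) pbundle \<Rightarrow> ('i, 'y, 's) pbundle \<Rightarrow> bool" where
  "isomorphic_bundles S P Q \<longleftrightarrow>
     (\<exists>T \<in> btrivs P. \<exists>T' \<in> btrivs Q. \<exists>\<Xi>.
        is_iso S (btop P, bproj P, T) (btop Q, bproj Q, T') \<Xi>)"

definition bundle_iso_rel ::
    "'s groupoid \<Rightarrow> (('i, 'x, 's) pbundle \<times> ('i, 'x, 's) pbundle) set" where
  "bundle_iso_rel S =
     {(P, Q). principal_bundle S P \<and> principal_bundle S Q \<and> isomorphic_bundles S P Q}"

text \<open>Isomorphism classes of the principal bundles whose points lie in \<open>'x\<close> and whose covers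
  are indexed by \<open>'i\<close>. These types act as universes: no bundle is lost, up to isomorphism, as
  soon as \<open>'x\<close> contains a copy of the set \<open>S\<close> and \<open>'i\<close> a copy of the set of open
  subsets of the unit space.\<close>

definition bundle_classes :: "'s groupoid \<Rightarrow> ('i, 'x, 's) pbundle set set" where
  "bundle_classes S = {P. principal_bundle S P} // bundle_iso_rel S"

end

theory Submission
  imports Defs
begin

text \<open>An isomorphism of principal bundles is the same as a homeomorphism over the unit space that
  preserves all ratios \<open>\<phi> x \<cdot> (\<phi> y)\<inverse>\<close> of points in a common fibre: on a common
  refinement, the correcting sections can be read off at the units, so they are continuous for free.
  Hence isomorphisms compose. Comparing charts shows that two bundles are isomorphic iff their
  cocycles become cohomologous on a common refinement: the local maps \<open>\<psi>\<inverse> (\<beta> \<cdot> \<phi> x)\<close>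
  agree on overlaps precisely because of this relation. Conversely, every cocycle glues the sets
  \<open>S|U\<^sub>i\<close> to a principal bundle. Transitivity of the relation defining the direct limit is
  inherited from the composition of isomorphisms of the glued bundles.\<close>

section \<open>Fibrewise algebra and continuity\<close>

text \<open>The obstacle to transitivity: relating \<open>\<gamma>\<close> to \<open>\<eta>\<close>
  and \<open>\<eta>\<close> to \<open>\<zeta>\<close> involves two refining maps
  \<open>\<sigma>\<close> and \<open>\<rho>'\<close> into the cover of \<open>\<eta>\<close>. On a
  common refinement the two pullbacks of \<open>\<eta>\<close> may differ, namely by the coboundary
  of \<open>\<eta> (\<sigma> k, \<rho>' k)\<close>. Ratio preservation mentions neither refinements
  nor refining maps, so this comparison disappears: only homeomorphisms are composed, and a
  refinement is chosen afresh afterwards. A ratio does not depend on the chart, because a change of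
  chart multiplies both entries by the same element and the fibres are commutative; it is the
  division map of a torsor. The types \<open>'x\<close> and \<open>'i\<close> are fixed, so the
  constructions must find room in them. \<open>e\<close> gives room for points: a glued bundle has
  the fibres of \<open>S\<close>, hence can be carried by a copy of \<open>S\<close>.
  \<open>g\<close> gives room for common refinements: their members are named by the open sets that
  they are, instead of by pairs of indices. One evaluation recurs: at the point whose coordinate in
  a chart is the unit, identities between charts become identities between sections.\<close>

locale ab_bundle =
  fixes S :: "'s groupoid"
  assumes abelian: "abelian_bundle S"
begin

abbreviation mul (infixl "\<cdot>" 70) where "x \<cdot> y \<equiv> gmult S x y"
abbreviation iv where "iv x \<equiv> ginv S x"
abbreviation p where "p \<equiv> gproj S"
abbreviation G where "G \<equiv> gset S"

lemma groupoid: "groupoid S"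
  using abelian by (simp add: abelian_bundle_def group_bundle_def lch_groupoid_def)

lemma iv_closed [simp]: "s \<in> G \<Longrightarrow> iv s \<in> G"
  and iv_iv [simp]: "s \<in> G \<Longrightarrow> iv (iv s) = s"
  using groupoid by (auto simp: groupoid_def)

lemma iv_mul: "s \<in> G \<Longrightarrow> iv s \<cdot> s = p s"
  using abelian by (simp add: abelian_bundle_def group_bundle_def gsource_def)

lemma mul_iv: "s \<in> G \<Longrightarrow> s \<cdot> iv s = p s"
  by (simp add: grange_def)

lemma p_iv [simp]: "s \<in> G \<Longrightarrow> p (iv s) = p s"
  by (simp add: grange_def[of S "iv s"] iv_mul)

lemma p_in_units [simp]: "s \<in> G \<Longrightarrow> p s \<in> gunits S"
  by (simp add: gunits_def)

lemma fibre_comm_group: "u \<in> gunits S \<Longrightarrow> comm_group (fibre S u)"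
  using abelian by (simp add: abelian_bundle_def)

text \<open>The neutral element of the group \<open>fibre S u\<close> is \<open>u\<close> itself,
  and a neutral element belongs to its carrier. So the group axioms of the fibre already contain
  that \<open>p\<close> fixes units.\<close>

lemma unit_fibre: "u \<in> gunits S \<Longrightarrow> u \<in> G \<and> p u = u"
  using comm_group.axioms(1)[OF fibre_comm_group] monoid.one_closed
  by (fastforce simp: fibre_def comm_monoid_def)

lemma unit_in [simp]: "u \<in> gunits S \<Longrightarrow> u \<in> G"
  and p_unit [simp]: "u \<in> gunits S \<Longrightarrow> p u = u"
  using unit_fibre by auto

lemma units_subset: "gunits S \<subseteq> G"
  by auto

lemma mul_closed [simp]:
  assumes "s \<in> G" "t \<in> G" "p s = p t"
  shows "s \<cdot> t \<in> G" "p (s \<cdot> t) = p t"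
proof -
  interpret comm_group "fibre S (p t)"
    using assms by (intro fibre_comm_group) simp
  have "s \<cdot> t \<in> carrier (fibre S (p t))"
    using m_closed[of s t] assms by (simp add: fibre_def)
  then show "s \<cdot> t \<in> G" "p (s \<cdot> t) = p t"
    by (simp_all add: fibre_def)
qed

lemma mul_assoc:
  assumes "s \<in> G" "t \<in> G" "r \<in> G" "p s = p t" "p t = p r"
  shows "s \<cdot> t \<cdot> r = s \<cdot> (t \<cdot> r)"
proof -
  interpret comm_group "fibre S (p t)"
    using assms by (intro fibre_comm_group) simp
  show ?thesis
    using m_assoc[of s t r] assms by (simp add: fibre_def)
qed

lemma mul_comm:
  assumes "s \<in> G" "t \<in> G" "p s = p t"
  shows "s \<cdot> t = t \<cdot> s"
proof -
  interpret comm_group "fibre S (p t)"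
    using assms by (intro fibre_comm_group) simp
  show ?thesis
    using m_comm[of s t] assms by (simp add: fibre_def)
qed

lemma mul_lcomm:
  assumes "s \<in> G" "t \<in> G" "r \<in> G" "p s = p t" "p t = p r"
  shows "s \<cdot> (t \<cdot> r) = t \<cdot> (s \<cdot> r)"
  using assms by (simp add: mul_assoc[symmetric] mul_comm[of s t])

lemma unit_mul [simp]:
  assumes "s \<in> G" "p s = u"
  shows "u \<cdot> s = s" "s \<cdot> u = s"
proof -
  interpret comm_group "fibre S (p s)"
    by (intro fibre_comm_group) (simp add: assms(1))
  show "u \<cdot> s = s" "s \<cdot> u = s"
    using l_one[of s] r_one[of s] assms by (simp_all add: fibre_def)
qed

lemma iv_mul_cancel [simp]:
  assumes "s \<in> G" "t \<in> G" "p s = p t"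
  shows "iv s \<cdot> (s \<cdot> t) = t" "s \<cdot> (iv s \<cdot> t) = t"
  using assms by (simp_all add: mul_assoc[symmetric] iv_mul mul_iv)

lemma mul_left_cancel:
  assumes "s \<cdot> t = s \<cdot> r" "s \<in> G" "t \<in> G" "r \<in> G" "p s = p t" "p s = p r"
  shows "t = r"
proof -
  have "t = iv s \<cdot> (s \<cdot> t)"
    by (rule iv_mul_cancel(1)[OF assms(2,3,5), symmetric])
  also have "\<dots> = iv s \<cdot> (s \<cdot> r)"
    unfolding assms(1) ..
  also have "\<dots> = r"
    by (rule iv_mul_cancel(1)[OF assms(2,4,6)])
  finally show ?thesis .
qed

lemma mul_right_cancel:
  assumes "t \<cdot> s = r \<cdot> s" "s \<in> G" "t \<in> G" "r \<in> G" "p s = p t" "p s = p r"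
  shows "t = r"
proof (rule mul_left_cancel[of s])
  show "s \<cdot> t = s \<cdot> r"
    using assms(1) mul_comm[of s t] mul_comm[of s r] assms(2-) by simp
qed (use assms in auto)

lemma iv_mul_distrib:
  assumes "s \<in> G" "t \<in> G" "p s = p t"
  shows "iv (s \<cdot> t) = iv s \<cdot> iv t"
proof (rule mul_left_cancel[of "s \<cdot> t"])
  show "s \<cdot> t \<cdot> iv (s \<cdot> t) = s \<cdot> t \<cdot> (iv s \<cdot> iv t)"
    using assms by (simp add: mul_iv mul_assoc mul_lcomm[of t "iv s"])
qed (use assms in auto)

lemma iv_unit [simp]: "u \<in> gunits S \<Longrightarrow> iv u = u"
  by (metis iv_mul p_unit unit_in iv_closed p_iv unit_mul(2))

text \<open>The common unit \<open>p s = p t\<close> composes with \<open>s\<close> on the left and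
  with \<open>t\<close> on the right; chaining through it gives the pair
  \<open>(s \<cdot> p s, t)\<close>, which is \<open>(s, t)\<close>. This is how the abstract set
  \<open>gcomp S\<close> is reached, on which alone multiplication is assumed continuous.\<close>

lemma composable:
  assumes "s \<in> G" "t \<in> G" "p s = p t"
  shows "(s, t) \<in> gcomp S"
proof -
  have comp: "(x, y) \<in> gcomp S \<Longrightarrow> (y, z) \<in> gcomp S \<Longrightarrow>
      (x \<cdot> y, z) \<in> gcomp S \<and> (x, y \<cdot> z) \<in> gcomp S" for x y z
    using groupoid unfolding groupoid_def by blast
  have inv: "(iv x, x) \<in> gcomp S \<and> (x, iv x) \<in> gcomp S" if "x \<in> G" for x
    using groupoid that unfolding groupoid_def by blast
  have "(s, p s) \<in> gcomp S"
    using comp[of s "iv s" s] inv[of s] assms by (simp add: iv_mul)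
  moreover have "(p s, t) \<in> gcomp S"
    using comp[of t "iv t" t] inv[of t] assms by (simp add: mul_iv)
  ultimately have "(s \<cdot> p s, t) \<in> gcomp S"
    using comp by blast
  then show ?thesis
    using assms by simp
qed

section \<open>Continuity of the fibrewise operations and of the projection\<close>

lemma continuous_iv: "continuous_map (gtop S) (gtop S) (ginv S)"
  and Hausdorff: "Hausdorff_space (gtop S)"
  and locally_compact: "locally_compact_space (gtop S)"
  and continuous_gmult: "continuous_map (subtopology (prod_topology (gtop S) (gtop S)) (gcomp S))
      (gtop S) (\<lambda>(x, y). gmult S x y)"
  using abelian by (simp_all add: abelian_bundle_def group_bundle_def lch_groupoid_def)

lemma continuous_mul:
  assumes f: "continuous_map Z (gtop S) f" and g: "continuous_map Z (gtop S) g"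
    and "\<And>z. z \<in> topspace Z \<Longrightarrow> p (f z) = p (g z)"
  shows "continuous_map Z (gtop S) (\<lambda>z. f z \<cdot> g z)"
proof -
  have "f z \<in> G" "g z \<in> G" if "z \<in> topspace Z" for z
    using f g that by (auto simp: continuous_map_def)
  then have "continuous_map Z (subtopology (prod_topology (gtop S) (gtop S)) (gcomp S))
      (\<lambda>z. (f z, g z))"
    using assms by (auto simp: continuous_map_in_subtopology continuous_map_paired composable)
  from continuous_map_compose[OF this continuous_gmult] show ?thesis
    by (simp add: o_def)
qed

lemma continuous_inv:
  "continuous_map Z (gtop S) f \<Longrightarrow> continuous_map Z (gtop S) (\<lambda>z. iv (f z))"
  using continuous_map_compose[OF _ continuous_iv] by (simp add: o_def)

lemma topspace_unit_top [simp]: "topspace (unit_top S) = gunits S"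
  using units_subset by (auto simp: unit_top_def)

lemma continuous_p: "continuous_map (gtop S) (unit_top S) p"
proof -
  have "continuous_map (gtop S) (gtop S) p"
    by (rule continuous_map_eq[OF continuous_mul[OF continuous_map_id continuous_iv]])
      (simp_all add: mul_iv)
  then show ?thesis
    by (auto simp: unit_top_def continuous_map_in_subtopology)
qed

lemma openin_grestr:
  assumes "openin (unit_top S) U"
  shows "openin (gtop S) (grestr S U)"
  using openin_continuous_map_preimage[OF continuous_p assms] by (simp add: grestr_def)


section \<open>Sections, covers and trivializations\<close>

lemma openin_units_subset: "openin (unit_top S) U \<Longrightarrow> U \<subseteq> gunits S"
  using openin_subset by fastforce

lemma carrier_sections:
  "f \<in> carrier (sections S U) \<longleftrightarrow> f \<in> extensional U \<and>
    continuous_map (subtopology (unit_top S) U) (gtop S) f \<and> (\<forall>u\<in>U. p (f u) = u)"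
  by (simp add: sections_def)

lemma sectionD:
  assumes "f \<in> carrier (sections S U)" "U \<subseteq> gunits S" "u \<in> U"
  shows "f u \<in> G" "p (f u) = u"
  using assms by (auto simp: carrier_sections continuous_map_def)

lemma sectionI:
  assumes "continuous_map (subtopology (unit_top S) U) (gtop S) f" "\<And>u. u \<in> U \<Longrightarrow> p (f u) = u"
  shows "restrict f U \<in> carrier (sections S U)"
  using assms by (auto simp: carrier_sections intro: continuous_map_eq)

lemma section_restrict:
  assumes "f \<in> carrier (sections S U)" "V \<subseteq> U"
  shows "restrict f V \<in> carrier (sections S V)"
  using assms by (intro sectionI)
    (auto simp: carrier_sections dest: continuous_map_from_subtopology_mono)

lemma section_mul:
  assumes "f \<in> carrier (sections S U)" "g \<in> carrier (sections S U)" "U \<subseteq> gunits S"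
  shows "(\<lambda>u\<in>U. f u \<cdot> g u) \<in> carrier (sections S U)"
  using assms sectionD[OF assms(1,3)] sectionD[OF assms(2,3)]
  by (intro sectionI continuous_mul) (auto simp: carrier_sections)

lemma section_iv:
  assumes "f \<in> carrier (sections S U)" "U \<subseteq> gunits S"
  shows "(\<lambda>u\<in>U. iv (f u)) \<in> carrier (sections S U)"
  using assms sectionD[OF assms(1,2)]
  by (intro sectionI continuous_inv) (auto simp: carrier_sections)

lemma continuous_unit_incl: "continuous_map (subtopology (unit_top S) U) (gtop S) (\<lambda>u. u)"
  using continuous_map_from_subtopology continuous_map_id unfolding unit_top_def id_def by blast

lemma section_unit: "U \<subseteq> gunits S \<Longrightarrow> (\<lambda>u\<in>U. u) \<in> carrier (sections S U)"
  by (intro sectionI continuous_unit_incl) auto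

section \<open>Covers, cochains and refinements\<close>

lemma open_coverD:
  assumes "open_cover S (I, U)"
  shows "i \<in> I \<Longrightarrow> openin (unit_top S) (U i)" "i \<in> I \<Longrightarrow> U i \<subseteq> gunits S"
    "u \<in> gunits S \<Longrightarrow> \<exists>i\<in>I. u \<in> U i"
  using assms openin_units_subset by (auto simp: open_cover_def)

lemma carrier_cochains0:
  "\<beta> \<in> carrier (cochains0 S (I, U)) \<longleftrightarrow> \<beta> \<in> (\<Pi>\<^sub>E i\<in>I. carrier (sections S (U i)))"
  by (simp add: cochains0_def)

lemma carrier_cochains1:
  "\<gamma> \<in> carrier (cochains1 S (I, U)) \<longleftrightarrow>
    \<gamma> \<in> extensional (I \<times> I) \<and> (\<forall>i\<in>I. \<forall>j\<in>I. \<gamma> (i, j) \<in> carrier (sections S (U i \<inter> U j)))"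
  by (auto simp: cochains1_def PiE_iff)

lemma cochain0D:
  assumes "open_cover S (I, U)" "\<beta> \<in> carrier (cochains0 S (I, U))" "i \<in> I" "u \<in> U i"
  shows "\<beta> i u \<in> G" "p (\<beta> i u) = u"
  using assms open_coverD[OF assms(1)] sectionD[of "\<beta> i" "U i" u]
  by (auto simp: carrier_cochains0)

lemma cochain1D:
  assumes "open_cover S (I, U)" "\<gamma> \<in> carrier (cochains1 S (I, U))" "i \<in> I" "j \<in> I"
    "u \<in> U i" "u \<in> U j"
  shows "\<gamma> (i, j) u \<in> G" "p (\<gamma> (i, j) u) = u"
  using assms open_coverD(2)[OF assms(1,3)] sectionD[of "\<gamma> (i, j)" "U i \<inter> U j" u]
  by (auto simp: carrier_cochains1)

lemma refines_viaD:
  assumes "refines_via (K, W) \<rho> (I, U)" "k \<in> K"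
  shows "\<rho> k \<in> I" "W k \<subseteq> U (\<rho> k)"
  using assms by (auto simp: refines_via_def)

text \<open>The pairwise intersections refine both covers, but \<open>'i\<close> need not have room
  for pairs of indices. It has room for open sets, through \<open>g\<close>, so each intersection is
  indexed by its own code.\<close>

lemma common_refinement:
  fixes g :: "'s set \<Rightarrow> 'i"
  assumes g: "inj_on g {U. openin (unit_top S) U}"
    and U: "open_cover S (I, U)" and V: "open_cover S (J, V)"
  obtains K :: "'i set" and W \<rho> \<sigma> where "open_cover S (K, W)" "refines_via (K, W) \<rho> (I, U)"
    "refines_via (K, W) \<sigma> (J, V)"
proof -
  let ?O = "{U. openin (unit_top S) U}"
  define K where "K = g ` {U i \<inter> V j | i j. i \<in> I \<and> j \<in> J}"
  define W where "W = inv_into ?O g"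
  have UV: "openin (unit_top S) (U i \<inter> V j)" if "i \<in> I" "j \<in> J" for i j
    using open_coverD(1)[OF U that(1)] open_coverD(1)[OF V that(2)] by blast
  have W: "W (g (U i \<inter> V j)) = U i \<inter> V j" if "i \<in> I" "j \<in> J" for i j
    unfolding W_def using g UV[OF that] by (intro inv_into_f_f) auto
  \<comment> \<open>Different pairs \<open>(i, j)\<close> with the same intersection share one
    index; \<open>f\<close> picks one such pair per index, and its components become the refining
    maps.\<close>
  have "\<forall>k\<in>K. \<exists>ij. fst ij \<in> I \<and> snd ij \<in> J \<and> W k = U (fst ij) \<inter> V (snd ij)"
    using W by (force simp: K_def)
  then obtain f where f: "\<forall>k\<in>K. fst (f k) \<in> I \<and> snd (f k) \<in> J \<and>
      W k = U (fst (f k)) \<inter> V (snd (f k))"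
    by metis
  have "u \<in> (\<Union>k\<in>K. W k)" if u: "u \<in> gunits S" for u
  proof -
    obtain i j where "i \<in> I" "u \<in> U i" "j \<in> J" "u \<in> V j"
      using open_coverD(3)[OF U u] open_coverD(3)[OF V u] by blast
    then show ?thesis
      using W[of i j] by (auto simp: K_def)
  qed
  moreover have op: "openin (unit_top S) (W k)" if "k \<in> K" for k
    using f UV that by auto
  ultimately have "open_cover S (K, W)"
    using openin_units_subset by (auto simp: open_cover_def)
  moreover have "refines_via (K, W) (fst \<circ> f) (I, U)" "refines_via (K, W) (snd \<circ> f) (J, V)"
    using f by (auto simp: refines_via_def)
  ultimately show thesis
    using that by blast
qed

section \<open>Trivializations and isomorphisms read at points of the bundle\<close>

lemma lch_space_overD:
  assumes "lch_space_over S X q"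
  shows "continuous_map X (unit_top S) q" "x \<in> topspace X \<Longrightarrow> q x \<in> gunits S"
  using assms by (auto simp: lch_space_over_def)

lemma
  assumes T: "is_trivialization S X q ((I, U), \<phi>, \<gamma>)"
  shows triv_cover: "open_cover S (I, U)"
    and triv_cochain: "\<gamma> \<in> carrier (cochains1 S (I, U))"
    and triv_homeo: "i \<in> I \<Longrightarrow> homeomorphic_map (subtopology X (preim X q (U i)))
      (subtopology (gtop S) (grestr S (U i))) (\<phi> i)"
    and triv_p: "i \<in> I \<Longrightarrow> x \<in> topspace X \<Longrightarrow> q x \<in> U i \<Longrightarrow> p (\<phi> i x) = q x"
    and triv_eq: "i \<in> I \<Longrightarrow> j \<in> I \<Longrightarrow> s \<in> grestr S (U i \<inter> U j) \<Longrightarrow>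
        \<phi> i (inv_into (preim X q (U j)) (\<phi> j) s) = \<gamma> (i, j) (p s) \<cdot> s"
  using T by (auto simp: is_trivialization_def preim_def)

lemma chart_bij:
  assumes "homeomorphic_map (subtopology X (preim X q A)) (subtopology (gtop S) (grestr S A)) f"
  shows "bij_betw f (preim X q A) (grestr S A)"
  using assms by (auto simp: homeomorphic_eq_everything_map bij_betw_def preim_def grestr_def
    Int_absorb1 Collect_conj_eq)

lemma triv_bij:
  assumes "is_trivialization S X q ((I, U), \<phi>, \<gamma>)" "i \<in> I"
  shows "bij_betw (\<phi> i) (preim X q (U i)) (grestr S (U i))"
  using chart_bij[OF triv_homeo[OF assms]] .

lemma triv_G:
  assumes "is_trivialization S X q ((I, U), \<phi>, \<gamma>)" "i \<in> I" "x \<in> topspace X" "q x \<in> U i"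
  shows "\<phi> i x \<in> G"
  using bij_betwE[OF triv_bij[OF assms(1,2)]] assms by (auto simp: preim_def grestr_def)

lemma triv_inj:
  assumes "is_trivialization S X q ((I, U), \<phi>, \<gamma>)" "i \<in> I" "x \<in> topspace X" "q x \<in> U i"
    "y \<in> topspace X" "q y \<in> U i" "\<phi> i x = \<phi> i y"
  shows "x = y"
  using bij_betw_imp_inj_on[OF triv_bij[OF assms(1,2)]] assms
  by (auto simp: preim_def inj_on_def)

lemma triv_surj:
  assumes T: "is_trivialization S X q ((I, U), \<phi>, \<gamma>)" and i: "i \<in> I" and s: "s \<in> G" "p s \<in> U i"
  obtains x where "x \<in> topspace X" "q x = p s" "\<phi> i x = s"
    "x = inv_into (preim X q (U i)) (\<phi> i) s"
proof -
  have "s \<in> \<phi> i ` preim X q (U i)"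
    unfolding bij_betw_imp_surj_on[OF triv_bij[OF T i]] using s by (simp add: grestr_def)
  then obtain x where x: "x \<in> preim X q (U i)" "\<phi> i x = s"
    by blast
  moreover have "inv_into (preim X q (U i)) (\<phi> i) s = x"
    using x bij_betw_imp_inj_on[OF triv_bij[OF T i]] by (auto intro: inv_into_f_eq)
  ultimately show thesis
    using that triv_p[OF T i, of x] by (auto simp: preim_def)
qed

text \<open>The substitution \<open>s = f x\<close>. The definitions speak of elements of
  \<open>S\<close> and inverse charts; this moves them to points \<open>x\<close> of the bundle,
  where the transition and isomorphism formulas involve no inverse.\<close>

lemma all_grestr_iff:
  assumes bij: "bij_betw f (preim X q U) (grestr S U)"
    and p: "\<And>x. x \<in> topspace X \<Longrightarrow> q x \<in> U \<Longrightarrow> p (f x) = q x" and "W \<subseteq> U"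
  shows "(\<forall>s\<in>grestr S W. P (inv_into (preim X q U) f s) s) \<longleftrightarrow> (\<forall>x\<in>preim X q W. P x (f x))"
proof -
  have "x \<in> preim X q U" "inv_into (preim X q U) f (f x) = x" "f x \<in> grestr S W"
    if "x \<in> preim X q W" for x
  proof -
    show *: "x \<in> preim X q U"
      using that \<open>W \<subseteq> U\<close> by (auto simp: preim_def)
    show "inv_into (preim X q U) f (f x) = x"
      using * bij by (simp add: bij_betw_imp_inj_on)
    show "f x \<in> grestr S W"
      using bij_betwE[OF bij] * that p by (auto simp: preim_def grestr_def)
  qed
  moreover have "inv_into (preim X q U) f s \<in> preim X q W" "f (inv_into (preim X q U) f s) = s"
    if "s \<in> grestr S W" for s
  proof -
    have *: "s \<in> f ` preim X q U"
      using that \<open>W \<subseteq> U\<close> bij by (auto simp: bij_betw_def grestr_def)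
    show "f (inv_into (preim X q U) f s) = s"
      using f_inv_into_f[OF *] .
    then show "inv_into (preim X q U) f s \<in> preim X q W"
      using inv_into_into[OF *] p[of "inv_into (preim X q U) f s"] that
      by (auto simp: preim_def grestr_def)
  qed
  ultimately show ?thesis
    by metis
qed

lemma triv_trans:
  assumes T: "is_trivialization S X q ((I, U), \<phi>, \<gamma>)" and ij: "i \<in> I" "j \<in> I"
    and x: "x \<in> topspace X" "q x \<in> U i" "q x \<in> U j"
  shows "\<phi> i x = \<gamma> (i, j) (q x) \<cdot> \<phi> j x"
proof -
  have "\<forall>x\<in>preim X q (U i \<inter> U j). \<phi> i x = \<gamma> (i, j) (p (\<phi> j x)) \<cdot> \<phi> j x"
    using all_grestr_iff[OF triv_bij[OF T ij(2)] triv_p[OF T ij(2)], of "U i \<inter> U j"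
        "\<lambda>x s. \<phi> i x = \<gamma> (i, j) (p s) \<cdot> s"] triv_eq[OF T ij] by simp
  then show ?thesis
    using x triv_p[OF T ij(2)] by (auto simp: preim_def)
qed

lemma is_trivializationI:
  assumes cover: "open_cover S (I, U)" and coch: "\<gamma> \<in> carrier (cochains1 S (I, U))"
    and homeo: "\<And>i. i \<in> I \<Longrightarrow> homeomorphic_map (subtopology X (preim X q (U i)))
      (subtopology (gtop S) (grestr S (U i))) (\<phi> i)"
    and p: "\<And>i x. i \<in> I \<Longrightarrow> x \<in> topspace X \<Longrightarrow> q x \<in> U i \<Longrightarrow> p (\<phi> i x) = q x"
    and trans: "\<And>i j x. i \<in> I \<Longrightarrow> j \<in> I \<Longrightarrow> x \<in> topspace X \<Longrightarrow> q x \<in> U i \<Longrightarrow> q x \<in> U j \<Longrightarrow>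
      \<phi> i x = \<gamma> (i, j) (q x) \<cdot> \<phi> j x"
  shows "is_trivialization S X q ((I, U), \<phi>, \<gamma>)"
proof -
  have "\<forall>s\<in>grestr S (U i \<inter> U j).
      \<phi> i (inv_into (preim X q (U j)) (\<phi> j) s) = \<gamma> (i, j) (p s) \<cdot> s" if ij: "i \<in> I" "j \<in> I" for i j
    using all_grestr_iff[OF chart_bij[OF homeo[OF ij(2)]] p[OF ij(2)], of "U i \<inter> U j"
        "\<lambda>x s. \<phi> i x = \<gamma> (i, j) (p s) \<cdot> s"] trans[OF ij] p[OF ij(2)] by (simp add: preim_def)
  then show ?thesis
    unfolding is_trivialization_def prod.case using cover coch homeo p by (auto simp: preim_def)
qed

text \<open>Only charts of the source are inverted in the definition of an isomorphism, so a
  trivialization of the source suffices for the substitution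
  \<open>s = \<phi> (\<rho> k) x\<close>.\<close>

lemma is_iso_iff:
  assumes T: "is_trivialization S X q ((I, U), \<phi>, \<gamma>)"
  shows "is_iso S (X, q, (I, U), \<phi>, \<gamma>) (Y, r, (J, V), \<psi>, \<eta>) ((K, W), \<rho>, \<sigma>, \<Omega>, \<beta>) \<longleftrightarrow>
     open_cover S (K, W) \<and> refines_via (K, W) \<rho> (I, U) \<and> refines_via (K, W) \<sigma> (J, V) \<and>
     homeomorphic_map X Y \<Omega> \<and> (\<forall>x \<in> topspace X. r (\<Omega> x) = q x) \<and>
     \<beta> \<in> carrier (cochains0 S (K, W)) \<and>
     (\<forall>k\<in>K. \<forall>x\<in>topspace X. q x \<in> W k \<longrightarrow> \<psi> (\<sigma> k) (\<Omega> x) = \<beta> k (q x) \<cdot> \<phi> (\<rho> k) x)"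
proof -
  have "(\<forall>s \<in> grestr S (W k). \<psi> (\<sigma> k) (\<Omega> (inv_into (preim X q (U (\<rho> k))) (\<phi> (\<rho> k)) s)) =
          \<beta> k (p s) \<cdot> s) \<longleftrightarrow>
      (\<forall>x\<in>topspace X. q x \<in> W k \<longrightarrow> \<psi> (\<sigma> k) (\<Omega> x) = \<beta> k (q x) \<cdot> \<phi> (\<rho> k) x)"
    if "refines_via (K, W) \<rho> (I, U)" "k \<in> K" for k
  proof -
    note rk = refines_viaD[OF that]
    show ?thesis
      using rk all_grestr_iff[OF triv_bij[OF T rk(1)] triv_p[OF T rk(1)] rk(2),
          of "\<lambda>x s. \<psi> (\<sigma> k) (\<Omega> x) = \<beta> k (p s) \<cdot> s"] triv_p[OF T rk(1)]
      by (auto simp: preim_def subset_iff)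
  qed
  then show ?thesis
    by (auto simp: is_iso_def)
qed


section \<open>Isomorphisms and ratios\<close>

text \<open>The left side is the conjugate of \<open>a \<cdot> iv b\<close> by \<open>c\<close>, and
  conjugation is trivial in a commutative fibre.\<close>

lemma ratio_mul:
  assumes "c \<in> G" "a \<in> G" "b \<in> G" "p a = p c" "p b = p c"
  shows "c \<cdot> a \<cdot> iv (c \<cdot> b) = a \<cdot> iv b"
  using assms by (simp add: iv_mul_distrib mul_assoc mul_lcomm[of a "iv c"])

text \<open>Passing from chart \<open>j\<close> to chart \<open>i\<close> multiplies both
  coordinates by the same value of \<open>\<gamma> (i, j)\<close>, which cancels. The ratio is
  therefore intrinsic to the two points: it is the element of \<open>S\<close> that carries
  \<open>y\<close> to \<open>x\<close>.\<close>

lemma triv_ratio: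
  assumes T: "is_trivialization S X q ((I, U), \<phi>, \<gamma>)" and ij: "i \<in> I" "j \<in> I"
    and xy: "x \<in> topspace X" "y \<in> topspace X" "q x = q y" "q y \<in> U i" "q y \<in> U j"
  shows "\<phi> i x \<cdot> iv (\<phi> i y) = \<phi> j x \<cdot> iv (\<phi> j y)"
proof -
  have "\<phi> i x = \<gamma> (i, j) (q y) \<cdot> \<phi> j x" "\<phi> i y = \<gamma> (i, j) (q y) \<cdot> \<phi> j y"
    using triv_trans[OF T ij] xy by auto
  then show ?thesis
    using ratio_mul[of "\<gamma> (i, j) (q y)" "\<phi> j x" "\<phi> j y"] triv_G[OF T ij(2)] triv_p[OF T ij(2)]
      cochain1D[OF triv_cover[OF T] triv_cochain[OF T] ij] xy by simp
qed

text \<open>An isomorphism stripped of its auxiliary data: all pairs of charts are compared, so no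
  refinement, refining map or correcting section has to be carried along when maps are
  composed.\<close>

definition preserves_ratios ::
    "'x topology \<Rightarrow> ('x \<Rightarrow> 's) \<Rightarrow> ('i, 'x, 's) trivialization \<Rightarrow> ('i, 'y, 's) trivialization \<Rightarrow>
      ('x \<Rightarrow> 'y) \<Rightarrow> bool" where
  "preserves_ratios X q = (\<lambda>((I, U), \<phi>, \<gamma>) ((J, V), \<psi>, \<eta>) \<Omega>.
     \<forall>i\<in>I. \<forall>j\<in>J. \<forall>x\<in>topspace X. \<forall>y\<in>topspace X. q x = q y \<and> q y \<in> U i \<and> q y \<in> V j \<longrightarrow>
       \<psi> j (\<Omega> x) \<cdot> iv (\<psi> j (\<Omega> y)) = \<phi> i x \<cdot> iv (\<phi> i y))"

lemma preserves_ratiosD: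
  assumes "preserves_ratios X q ((I, U), \<phi>, \<gamma>) ((J, V), \<psi>, \<eta>) \<Omega>" "i \<in> I" "j \<in> J"
    "x \<in> topspace X" "y \<in> topspace X" "q x = q y" "q y \<in> U i" "q y \<in> V j"
  shows "\<psi> j (\<Omega> x) \<cdot> iv (\<psi> j (\<Omega> y)) = \<phi> i x \<cdot> iv (\<phi> i y)"
  using assms by (auto simp: preserves_ratios_def)

text \<open>In the charts \<open>\<rho> k\<close> and \<open>\<sigma> k\<close> the map multiplies
  by \<open>\<beta> k\<close>, which drops out of the ratio; chart independence on both sides then
  moves from these charts to arbitrary \<open>i\<close> and \<open>j\<close>.\<close>

lemma iso_preserves_ratios:
  assumes T: "is_trivialization S X q ((I, U), \<phi>, \<gamma>)"
    and T': "is_trivialization S Y r ((J, V), \<psi>, \<eta>)" and X: "lch_space_over S X q"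
    and iso: "is_iso S (X, q, (I, U), \<phi>, \<gamma>) (Y, r, (J, V), \<psi>, \<eta>) ((K, W), \<rho>, \<sigma>, \<Omega>, \<beta>)"
  shows "preserves_ratios X q ((I, U), \<phi>, \<gamma>) ((J, V), \<psi>, \<eta>) \<Omega>"
  unfolding preserves_ratios_def prod.case
proof (intro ballI impI, elim conjE)
  fix i j x y
  assume ij: "i \<in> I" "j \<in> J" and xy: "x \<in> topspace X" "y \<in> topspace X" "q x = q y"
    "q y \<in> U i" "q y \<in> V j"
  have W: "open_cover S (K, W)" "refines_via (K, W) \<rho> (I, U)" "refines_via (K, W) \<sigma> (J, V)"
    and homeo: "homeomorphic_map X Y \<Omega>" and r: "\<And>x. x \<in> topspace X \<Longrightarrow> r (\<Omega> x) = q x"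
    and \<beta>: "\<beta> \<in> carrier (cochains0 S (K, W))"
    and eq: "\<And>k x. k \<in> K \<Longrightarrow> x \<in> topspace X \<Longrightarrow> q x \<in> W k \<Longrightarrow>
      \<psi> (\<sigma> k) (\<Omega> x) = \<beta> k (q x) \<cdot> \<phi> (\<rho> k) x"
    using iso unfolding is_iso_iff[OF T] by auto
  have \<Omega>: "\<Omega> x \<in> topspace Y" "\<Omega> y \<in> topspace Y"
    using homeomorphic_imp_surjective_map[OF homeo] xy by auto
  obtain k where k: "k \<in> K" "q y \<in> W k"
    using open_coverD(3)[OF W(1) lch_space_overD(2)[OF X xy(2)]] by blast
  note rk = refines_viaD[OF W(2) k(1)] and sk = refines_viaD[OF W(3) k(1)]
  have yk: "q y \<in> U (\<rho> k)" "q y \<in> V (\<sigma> k)"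
    using k rk sk by auto
  have "\<psi> j (\<Omega> x) \<cdot> iv (\<psi> j (\<Omega> y)) = \<psi> (\<sigma> k) (\<Omega> x) \<cdot> iv (\<psi> (\<sigma> k) (\<Omega> y))"
    using xy yk \<Omega> by (intro triv_ratio[OF T' ij(2) sk(1)]) (simp_all add: r)
  also have "\<dots> = \<beta> k (q y) \<cdot> \<phi> (\<rho> k) x \<cdot> iv (\<beta> k (q y) \<cdot> \<phi> (\<rho> k) y)"
    using eq k xy by simp
  also have "\<dots> = \<phi> (\<rho> k) x \<cdot> iv (\<phi> (\<rho> k) y)"
    using triv_G[OF T rk(1)] triv_p[OF T rk(1)] cochain0D[OF W(1) \<beta> k] xy yk
    by (intro ratio_mul) auto
  also have "\<dots> = \<phi> i x \<cdot> iv (\<phi> i y)"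
    using xy yk by (intro triv_ratio[OF T rk(1) ij(1)])
  finally show "\<psi> j (\<Omega> x) \<cdot> iv (\<psi> j (\<Omega> y)) = \<phi> i x \<cdot> iv (\<phi> i y)" .
qed

lemma continuous_chart_inv:
  assumes T: "is_trivialization S X q ((I, U), \<phi>, \<gamma>)" and i: "i \<in> I"
  shows "continuous_map (subtopology (gtop S) (grestr S (U i))) (subtopology X (preim X q (U i)))
    (inv_into (preim X q (U i)) (\<phi> i))"
proof -
  let ?X = "subtopology X (preim X q (U i))" and ?Y = "subtopology (gtop S) (grestr S (U i))"
  obtain f where f: "homeomorphic_maps ?X ?Y (\<phi> i) f"
    using triv_homeo[OF T i] homeomorphic_map_maps by blast
  have "inv_into (preim X q (U i)) (\<phi> i) s = f s" if "s \<in> grestr S (U i)" for s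
  proof (rule inv_into_f_eq[OF bij_betw_imp_inj_on[OF triv_bij[OF T i]]])
    have "s \<in> topspace ?Y"
      using that by (simp add: grestr_def)
    then have "f s \<in> topspace ?X" "\<phi> i (f s) = s"
      using f unfolding homeomorphic_maps_def continuous_map_def by blast+
    then show "f s \<in> preim X q (U i)" "\<phi> i (f s) = s"
      by auto
  qed
  moreover have "continuous_map ?Y ?X f"
    using f unfolding homeomorphic_maps_def by blast
  ultimately show ?thesis
    by (auto intro: continuous_map_eq)
qed

text \<open>Units over \<open>U i\<close> lie in \<open>grestr S (U i)\<close>, so the inverse chart
  restricts to them; the result is the local section of \<open>q\<close> whose coordinate is
  everywhere the unit.\<close>

lemma continuous_chart_section:
  assumes T: "is_trivialization S X q ((I, U), \<phi>, \<gamma>)" and i: "i \<in> I"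
  shows "continuous_map (subtopology (unit_top S) (U i)) X (inv_into (preim X q (U i)) (\<phi> i))"
proof -
  have "continuous_map (subtopology (unit_top S) (U i)) (subtopology (gtop S) (grestr S (U i)))
      (\<lambda>u. u)"
    using continuous_unit_incl[of "U i"] open_coverD(2)[OF triv_cover[OF T] i]
    by (auto simp: continuous_map_in_subtopology grestr_def subset_iff)
  from continuous_map_compose[OF this continuous_chart_inv[OF T i]] show ?thesis
    by (simp add: o_def continuous_map_in_subtopology)
qed

text \<open>On a common refinement, the section \<open>\<beta>\<close> of the isomorphism is the image of the unit
  section: \<open>\<beta> u = \<psi> (\<Omega> (\<phi>\<^sup>-\<^sup>1 u))\<close>. So continuity of \<open>\<beta>\<close> is automatic.\<close>

lemma preserves_ratios_iso:
  fixes g :: "'s set \<Rightarrow> 'i" and I J :: "'i set"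
  assumes g: "inj_on g {U. openin (unit_top S) U}"
    and T: "is_trivialization S X q ((I, U), \<phi>, \<gamma>)"
    and T': "is_trivialization S Y r ((J, V), \<psi>, \<eta>)"
    and homeo: "homeomorphic_map X Y \<Omega>" and r: "\<And>x. x \<in> topspace X \<Longrightarrow> r (\<Omega> x) = q x"
    and ratios: "preserves_ratios X q ((I, U), \<phi>, \<gamma>) ((J, V), \<psi>, \<eta>) \<Omega>"
  shows "\<exists>W \<rho> \<sigma> \<beta>. is_iso S (X, q, (I, U), \<phi>, \<gamma>) (Y, r, (J, V), \<psi>, \<eta>) (W, \<rho>, \<sigma>, \<Omega>, \<beta>)"
proof -
  obtain K :: "'i set" and W \<rho> \<sigma> where W: "open_cover S (K, W)"
    and \<rho>: "refines_via (K, W) \<rho> (I, U)" and \<sigma>: "refines_via (K, W) \<sigma> (J, V)"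
    using common_refinement[OF g triv_cover[OF T] triv_cover[OF T']] by blast
  define b where "b k u = \<psi> (\<sigma> k) (\<Omega> (inv_into (preim X q (U (\<rho> k))) (\<phi> (\<rho> k)) u))" for k u
  define \<beta> where "\<beta> = (\<lambda>k\<in>K. restrict (b k) (W k))"
  have \<Omega>: "\<Omega> x \<in> topspace Y" if "x \<in> topspace X" for x
    using homeomorphic_imp_surjective_map[OF homeo] that by auto
  have b: "\<exists>z\<in>topspace X. q z = u \<and> \<phi> (\<rho> k) z = u \<and> b k u = \<psi> (\<sigma> k) (\<Omega> z) \<and> p (b k u) = u"
    if k: "k \<in> K" and u: "u \<in> W k" for k u
  proof -
    have un: "u \<in> gunits S"
      using open_coverD(2)[OF W k] u by blast
    obtain z where z: "z \<in> topspace X" "q z = p u" "\<phi> (\<rho> k) z = u"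
      "z = inv_into (preim X q (U (\<rho> k))) (\<phi> (\<rho> k)) u"
      using triv_surj[OF T refines_viaD(1)[OF \<rho> k], of u] un u refines_viaD(2)[OF \<rho> k] by auto
    have "p (\<psi> (\<sigma> k) (\<Omega> z)) = r (\<Omega> z)"
      using refines_viaD[OF \<sigma> k] z un u by (intro triv_p[OF T'] \<Omega>) (auto simp: r)
    then show ?thesis
      using z un by (auto simp: b_def r)
  qed
  have "restrict (b k) (W k) \<in> carrier (sections S (W k))" if k: "k \<in> K" for k
  proof (rule sectionI)
    note rk = refines_viaD[OF \<rho> k] and sk = refines_viaD[OF \<sigma> k]
    have "continuous_map (subtopology (unit_top S) (W k)) X
        (inv_into (preim X q (U (\<rho> k))) (\<phi> (\<rho> k)))"
      using continuous_map_from_subtopology_mono[OF continuous_chart_section[OF T rk(1)] rk(2)] .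
    then have "continuous_map (subtopology (unit_top S) (W k)) Y
        (\<lambda>u. \<Omega> (inv_into (preim X q (U (\<rho> k))) (\<phi> (\<rho> k)) u))" (is "continuous_map ?W Y ?f")
      using continuous_map_compose[OF _ homeomorphic_imp_continuous_map[OF homeo]]
      by (fastforce simp: o_def)
    moreover have "?f u \<in> preim Y r (V (\<sigma> k))" if "u \<in> topspace ?W" for u
    proof -
      have u: "u \<in> W k" "u \<in> gunits S"
        using that by auto
      obtain z where "z \<in> topspace X" "q z = p u" "z = inv_into (preim X q (U (\<rho> k))) (\<phi> (\<rho> k)) u"
        using triv_surj[OF T rk(1), of u] u rk(2) by auto
      then show ?thesis
        using u sk(2) \<Omega> by (auto simp: preim_def r)
    qed
    ultimately have "continuous_map ?W (subtopology Y (preim Y r (V (\<sigma> k)))) ?f"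
      by (auto simp: continuous_map_in_subtopology)
    moreover have "continuous_map (subtopology Y (preim Y r (V (\<sigma> k)))) (gtop S) (\<psi> (\<sigma> k))"
      using homeomorphic_imp_continuous_map[OF triv_homeo[OF T' sk(1)]]
      by (simp add: continuous_map_in_subtopology)
    ultimately have "continuous_map ?W (gtop S) (\<psi> (\<sigma> k) \<circ> ?f)"
      by (rule continuous_map_compose)
    moreover have "\<psi> (\<sigma> k) \<circ> ?f = b k"
      by (auto simp: b_def)
    ultimately show "continuous_map ?W (gtop S) (b k)"
      by simp
    show "p (b k u) = u" if "u \<in> W k" for u
      using b[OF k that] by blast
  qed
  then have "\<beta> \<in> carrier (cochains0 S (K, W))"
    by (auto simp: carrier_cochains0 \<beta>_def)
  moreover have "\<psi> (\<sigma> k) (\<Omega> x) = \<beta> k (q x) \<cdot> \<phi> (\<rho> k) x"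
    if k: "k \<in> K" and x: "x \<in> topspace X" "q x \<in> W k" for k x
  proof -
    note rk = refines_viaD[OF \<rho> k] and sk = refines_viaD[OF \<sigma> k]
    obtain z where z: "z \<in> topspace X" "q z = q x" "\<phi> (\<rho> k) z = q x"
      "b k (q x) = \<psi> (\<sigma> k) (\<Omega> z)" "p (\<psi> (\<sigma> k) (\<Omega> z)) = q x"
      using b[OF k x(2)] by auto
    have un: "q x \<in> gunits S"
      using open_coverD(2)[OF W k] x by blast
    have U: "q x \<in> U (\<rho> k)" "q x \<in> V (\<sigma> k)"
      using rk sk x by auto
    have \<phi>: "\<phi> (\<rho> k) x \<in> G" "p (\<phi> (\<rho> k) x) = q x"
      using triv_G[OF T rk(1)] triv_p[OF T rk(1)] x U by auto
    have \<psi>: "\<psi> (\<sigma> k) (\<Omega> x) \<in> G" "p (\<psi> (\<sigma> k) (\<Omega> x)) = q x" "\<psi> (\<sigma> k) (\<Omega> z) \<in> G"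
      using triv_G[OF T' sk(1)] triv_p[OF T' sk(1)] x z U \<Omega> by (auto simp: r)
    \<comment> \<open>Since \<open>z\<close> has the unit as its coordinate, its ratio with
      \<open>x\<close> on the source side is \<open>\<phi> (\<rho> k) x\<close> itself, while
      \<open>\<psi> (\<sigma> k) (\<Omega> z)\<close> is the value of \<open>\<beta> k\<close> at
      \<open>q x\<close>. Clearing the inverse gives the required formula.\<close>
    have "\<psi> (\<sigma> k) (\<Omega> x) \<cdot> iv (\<psi> (\<sigma> k) (\<Omega> z)) = \<phi> (\<rho> k) x \<cdot> iv (\<phi> (\<rho> k) z)"
      using x z U by (intro preserves_ratiosD[OF ratios rk(1) sk(1)]) auto
    then have *: "\<phi> (\<rho> k) x = \<psi> (\<sigma> k) (\<Omega> x) \<cdot> iv (\<psi> (\<sigma> k) (\<Omega> z))"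
      using z \<phi> un by simp
    have "\<psi> (\<sigma> k) (\<Omega> z) \<cdot> \<phi> (\<rho> k) x = \<psi> (\<sigma> k) (\<Omega> x)"
      unfolding * using \<psi> z(5)
      by (simp add: mul_lcomm[of "\<psi> (\<sigma> k) (\<Omega> z)" "\<psi> (\<sigma> k) (\<Omega> x)"] mul_iv)
    then show ?thesis
      using k x z by (simp add: \<beta>_def)
  qed
  ultimately have "is_iso S (X, q, (I, U), \<phi>, \<gamma>) (Y, r, (J, V), \<psi>, \<eta>) ((K, W), \<rho>, \<sigma>, \<Omega>, \<beta>)"
    unfolding is_iso_iff[OF T] using W \<rho> \<sigma> homeo r by blast
  then show ?thesis
    by blast
qed

text \<open>Any chart of \<open>Y\<close> over \<open>q y\<close> can serve as intermediary, because
  both hypotheses hold for all charts of \<open>Y\<close>. There is nothing to match between two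
  choices of charts.\<close>

lemma preserves_ratios_compose:
  assumes T': "is_trivialization S Y r ((J, V), \<psi>, \<eta>)" and X: "lch_space_over S X q"
    and \<Omega>: "\<And>x. x \<in> topspace X \<Longrightarrow> \<Omega> x \<in> topspace Y \<and> r (\<Omega> x) = q x"
    and 1: "preserves_ratios X q ((I, U), \<phi>, \<gamma>) ((J, V), \<psi>, \<eta>) \<Omega>"
    and 2: "preserves_ratios Y r ((J, V), \<psi>, \<eta>) ((L, Z), \<xi>, \<zeta>) \<Omega>'"
  shows "preserves_ratios X q ((I, U), \<phi>, \<gamma>) ((L, Z), \<xi>, \<zeta>) (\<Omega>' \<circ> \<Omega>)"
  unfolding preserves_ratios_def prod.case
proof (intro ballI impI, elim conjE)
  fix i l x y
  assume il: "i \<in> I" "l \<in> L" and xy: "x \<in> topspace X" "y \<in> topspace X" "q x = q y"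
    "q y \<in> U i" "q y \<in> Z l"
  obtain j where j: "j \<in> J" "q y \<in> V j"
    using open_coverD(3)[OF triv_cover[OF T'] lch_space_overD(2)[OF X xy(2)]] by blast
  have "\<xi> l (\<Omega>' (\<Omega> x)) \<cdot> iv (\<xi> l (\<Omega>' (\<Omega> y))) = \<psi> j (\<Omega> x) \<cdot> iv (\<psi> j (\<Omega> y))"
    using xy j \<Omega> by (intro preserves_ratiosD[OF 2 j(1) il(2)]) auto
  also have "\<dots> = \<phi> i x \<cdot> iv (\<phi> i y)"
    using xy j by (intro preserves_ratiosD[OF 1 il(1) j(1)]) auto
  finally show "\<xi> l ((\<Omega>' \<circ> \<Omega>) x) \<cdot> iv (\<xi> l ((\<Omega>' \<circ> \<Omega>) y)) = \<phi> i x \<cdot> iv (\<phi> i y)"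
    by simp
qed


section \<open>Isomorphisms and cohomologous cocycles\<close>

text \<open>Equality of two classes in the direct limit, freed from cosets: after pullback to a
  common refinement the cocycles differ by the coboundary of \<open>\<beta>\<close>. The pointwise
  form is the one that charts produce.\<close>

definition cohomologous ::
    "('i, 's) cover \<Rightarrow> ('i \<times> 'i \<Rightarrow> 's \<Rightarrow> 's) \<Rightarrow> ('i, 's) cover \<Rightarrow> ('i \<times> 'i \<Rightarrow> 's \<Rightarrow> 's) \<Rightarrow> bool" where
  "cohomologous IU \<gamma> JV \<eta> \<longleftrightarrow> (\<exists>K W \<rho> \<sigma> \<beta>. open_cover S (K, W) \<and>
     refines_via (K, W) \<rho> IU \<and> refines_via (K, W) \<sigma> JV \<and> \<beta> \<in> carrier (cochains0 S (K, W)) \<and>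
     (\<forall>k\<in>K. \<forall>l\<in>K. \<forall>u\<in>W k \<inter> W l.
        \<eta> (\<sigma> k, \<sigma> l) u = \<beta> k u \<cdot> iv (\<beta> l u) \<cdot> \<gamma> (\<rho> k, \<rho> l) u))"

text \<open>At the point \<open>x\<close> with \<open>\<phi> (\<rho> l) x = u\<close>, the
  coordinate in chart \<open>\<rho> k\<close> is the value of \<open>\<gamma>\<close>, and the image
  has coordinate \<open>\<beta> l u\<close> in chart \<open>\<sigma> l\<close>. Computing
  \<open>\<psi> (\<sigma> k) (\<Omega> x)\<close> through \<open>\<eta>\<close> and through
  \<open>\<beta> k\<close> and cancelling \<open>\<beta> l u\<close> gives the relation.\<close>

lemma iso_cohomologous:
  assumes T: "is_trivialization S X q ((I, U), \<phi>, \<gamma>)"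
    and T': "is_trivialization S Y r ((J, V), \<psi>, \<eta>)" and X: "lch_space_over S X q"
    and iso: "is_iso S (X, q, (I, U), \<phi>, \<gamma>) (Y, r, (J, V), \<psi>, \<eta>) ((K, W), \<rho>, \<sigma>, \<Omega>, \<beta>)"
  shows "cohomologous (I, U) \<gamma> (J, V) \<eta>"
proof -
  have W: "open_cover S (K, W)" and \<rho>: "refines_via (K, W) \<rho> (I, U)"
    and \<sigma>: "refines_via (K, W) \<sigma> (J, V)"
    and homeo: "homeomorphic_map X Y \<Omega>" and r: "\<And>x. x \<in> topspace X \<Longrightarrow> r (\<Omega> x) = q x"
    and \<beta>: "\<beta> \<in> carrier (cochains0 S (K, W))"
    and eq: "\<And>k x. k \<in> K \<Longrightarrow> x \<in> topspace X \<Longrightarrow> q x \<in> W k \<Longrightarrow>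
      \<psi> (\<sigma> k) (\<Omega> x) = \<beta> k (q x) \<cdot> \<phi> (\<rho> k) x"
    using iso unfolding is_iso_iff[OF T] by auto
  have "\<eta> (\<sigma> k, \<sigma> l) u = \<beta> k u \<cdot> iv (\<beta> l u) \<cdot> \<gamma> (\<rho> k, \<rho> l) u"
    if kl: "k \<in> K" "l \<in> K" and u: "u \<in> W k" "u \<in> W l" for k l u
  proof -
    note rk = refines_viaD[OF \<rho> kl(1)] and sk = refines_viaD[OF \<sigma> kl(1)]
      and rl = refines_viaD[OF \<rho> kl(2)] and sl = refines_viaD[OF \<sigma> kl(2)]
    have U: "u \<in> U (\<rho> k)" "u \<in> U (\<rho> l)" "u \<in> V (\<sigma> k)" "u \<in> V (\<sigma> l)"
      using rk sk rl sl u by auto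
    have un: "u \<in> gunits S"
      using open_coverD(2)[OF W kl(1)] u by blast
    obtain x where x: "x \<in> topspace X" "q x = u" "\<phi> (\<rho> l) x = u"
      using triv_surj[OF T rl(1), of u] un U by auto
    have \<Omega>: "\<Omega> x \<in> topspace Y"
      using homeomorphic_imp_surjective_map[OF homeo] x by auto
    note b = cochain0D[OF W \<beta> kl(1) u(1)] cochain0D[OF W \<beta> kl(2) u(2)]
    note c = cochain1D[OF triv_cover[OF T] triv_cochain[OF T] rk(1) rl(1) U(1,2)]
      cochain1D[OF triv_cover[OF T'] triv_cochain[OF T'] sk(1) sl(1) U(3,4)]
    have "\<psi> (\<sigma> k) (\<Omega> x) = \<eta> (\<sigma> k, \<sigma> l) u \<cdot> \<psi> (\<sigma> l) (\<Omega> x)"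
      using triv_trans[OF T' sk(1) sl(1) \<Omega>] x U by (simp add: r)
    moreover have "\<psi> (\<sigma> k) (\<Omega> x) = \<beta> k u \<cdot> \<phi> (\<rho> k) x" "\<psi> (\<sigma> l) (\<Omega> x) = \<beta> l u"
      using eq[OF kl(1) x(1)] eq[OF kl(2) x(1)] x u b by auto
    moreover have "\<phi> (\<rho> k) x = \<gamma> (\<rho> k, \<rho> l) u"
      using triv_trans[OF T rk(1) rl(1) x(1)] x U c by simp
    ultimately have "\<eta> (\<sigma> k, \<sigma> l) u \<cdot> \<beta> l u = \<beta> k u \<cdot> \<gamma> (\<rho> k, \<rho> l) u"
      by simp
    also have "\<dots> = \<beta> k u \<cdot> iv (\<beta> l u) \<cdot> \<gamma> (\<rho> k, \<rho> l) u \<cdot> \<beta> l u"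
      using b c un by (simp add: mul_assoc mul_comm[of "\<gamma> (\<rho> k, \<rho> l) u" "\<beta> l u"])
    finally show ?thesis
      by (rule mul_right_cancel) (use b c in simp_all)
  qed
  then show ?thesis
    unfolding cohomologous_def using W \<rho> \<sigma> \<beta> by (intro exI[of _ K] exI) auto
qed

lemma openin_preim:
  assumes "lch_space_over S X q" "openin (unit_top S) W"
  shows "openin X (preim X q W)"
  using openin_continuous_map_preimage[OF lch_space_overD(1)[OF assms(1)] assms(2)]
  by (simp add: preim_def)

text \<open>Only one continuous map is produced. The statement is kept one-sided so that it can be
  used a second time, with the bundles exchanged and \<open>\<beta>\<close> inverted, to obtain the
  inverse map.\<close>

lemma cohomologous_map:
  assumes T: "is_trivialization S X q ((I, U), \<phi>, \<gamma>)"
    and T': "is_trivialization S Y r ((J, V), \<psi>, \<eta>)" and X: "lch_space_over S X q"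
    and W: "open_cover S (K, W)" and \<rho>: "refines_via (K, W) \<rho> (I, U)"
    and \<sigma>: "refines_via (K, W) \<sigma> (J, V)" and \<beta>: "\<beta> \<in> carrier (cochains0 S (K, W))"
    and eq: "\<And>k l u. k \<in> K \<Longrightarrow> l \<in> K \<Longrightarrow> u \<in> W k \<Longrightarrow> u \<in> W l \<Longrightarrow>
        \<eta> (\<sigma> k, \<sigma> l) u = \<beta> k u \<cdot> iv (\<beta> l u) \<cdot> \<gamma> (\<rho> k, \<rho> l) u"
  obtains \<Omega> where "continuous_map X Y \<Omega>" "\<And>x. x \<in> topspace X \<Longrightarrow> r (\<Omega> x) = q x"
    "\<And>k x. k \<in> K \<Longrightarrow> x \<in> topspace X \<Longrightarrow> q x \<in> W k \<Longrightarrow> \<psi> (\<sigma> k) (\<Omega> x) = \<beta> k (q x) \<cdot> \<phi> (\<rho> k) x"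
proof -
  define f where
    "f k x = inv_into (preim Y r (V (\<sigma> k))) (\<psi> (\<sigma> k)) (\<beta> k (q x) \<cdot> \<phi> (\<rho> k) x)" for k x
  have loc: "\<phi> (\<rho> k) x \<in> G \<and> p (\<phi> (\<rho> k) x) = q x \<and> \<beta> k (q x) \<in> G \<and> p (\<beta> k (q x)) = q x \<and>
      f k x \<in> topspace Y \<and> r (f k x) = q x \<and> \<psi> (\<sigma> k) (f k x) = \<beta> k (q x) \<cdot> \<phi> (\<rho> k) x"
    if k: "k \<in> K" and x: "x \<in> topspace X" "q x \<in> W k" for k x
  proof -
    note rk = refines_viaD[OF \<rho> k] and sk = refines_viaD[OF \<sigma> k]
    have \<phi>: "\<phi> (\<rho> k) x \<in> G" "p (\<phi> (\<rho> k) x) = q x"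
      using triv_G[OF T rk(1) x(1)] triv_p[OF T rk(1) x(1)] x rk(2) by auto
    have b: "\<beta> k (q x) \<in> G" "p (\<beta> k (q x)) = q x"
      using cochain0D[OF W \<beta> k x(2)] .
    show ?thesis
      using \<phi> b x sk(2) triv_surj[OF T' sk(1), of "\<beta> k (q x) \<cdot> \<phi> (\<rho> k) x"]
      by (auto simp: f_def)
  qed
  have agree: "f k x = f l x"
    if kl: "k \<in> K" "l \<in> K" and x: "x \<in> topspace X" "q x \<in> W k" "q x \<in> W l" for k l x
  proof -
    note rk = refines_viaD[OF \<rho> kl(1)] and sk = refines_viaD[OF \<sigma> kl(1)]
      and rl = refines_viaD[OF \<rho> kl(2)] and sl = refines_viaD[OF \<sigma> kl(2)]
    have U: "q x \<in> U (\<rho> k)" "q x \<in> U (\<rho> l)" "q x \<in> V (\<sigma> k)" "q x \<in> V (\<sigma> l)"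
      using rk sk rl sl x by auto
    note lk = loc[OF kl(1) x(1,2)] and ll = loc[OF kl(2) x(1,3)]
    note c = cochain1D[OF triv_cover[OF T] triv_cochain[OF T] rk(1) rl(1) U(1,2)]
    \<comment> \<open>Both candidates are compared in the single chart \<open>\<sigma> k\<close>:
      \<open>\<eta>\<close> transports \<open>f l x\<close> into it, the relation replaces
      \<open>\<eta>\<close> by \<open>\<gamma>\<close> and cancels \<open>\<beta> l\<close>, and
      \<open>\<gamma>\<close> transports \<open>\<phi> (\<rho> l) x\<close> to
      \<open>\<phi> (\<rho> k) x\<close>.\<close>
    have "\<psi> (\<sigma> k) (f l x) = \<eta> (\<sigma> k, \<sigma> l) (q x) \<cdot> \<psi> (\<sigma> l) (f l x)"
      using triv_trans[OF T' sk(1) sl(1), of "f l x"] ll U by simp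
    also have "\<dots> = \<beta> k (q x) \<cdot> iv (\<beta> l (q x)) \<cdot> \<gamma> (\<rho> k, \<rho> l) (q x) \<cdot>
        (\<beta> l (q x) \<cdot> \<phi> (\<rho> l) x)"
      using ll eq[OF kl x(2,3)] by simp
    also have "\<dots> = \<beta> k (q x) \<cdot> (\<gamma> (\<rho> k, \<rho> l) (q x) \<cdot> \<phi> (\<rho> l) x)"
      using lk ll c
      by (simp add: mul_assoc mul_lcomm[of "\<gamma> (\<rho> k, \<rho> l) (q x)" "\<beta> l (q x)"])
    also have "\<dots> = \<beta> k (q x) \<cdot> \<phi> (\<rho> k) x"
      using triv_trans[OF T rk(1) rl(1) x(1) U(1,2)] by simp
    also have "\<dots> = \<psi> (\<sigma> k) (f k x)"
      using lk by simp
    finally show ?thesis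
      using lk ll U by (intro triv_inj[OF T' sk(1)]) auto
  qed
  have cont: "continuous_map (subtopology X (preim X q (W k))) Y (f k)" if k: "k \<in> K" for k
  proof -
    note rk = refines_viaD[OF \<rho> k] and sk = refines_viaD[OF \<sigma> k]
    let ?X = "subtopology X (preim X q (W k))"
    have q: "continuous_map ?X (subtopology (unit_top S) (W k)) q"
      using lch_space_overD(1)[OF X]
      by (auto simp: continuous_map_in_subtopology preim_def intro: continuous_map_from_subtopology)
    have b: "continuous_map (subtopology (unit_top S) (W k)) (gtop S) (\<beta> k)"
      using \<beta> k by (auto simp: carrier_cochains0 carrier_sections)
    have "continuous_map (subtopology X (preim X q (U (\<rho> k)))) (gtop S) (\<phi> (\<rho> k))"
      using homeomorphic_imp_continuous_map[OF triv_homeo[OF T rk(1)]]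
      by (simp add: continuous_map_in_subtopology)
    then have \<phi>: "continuous_map ?X (gtop S) (\<phi> (\<rho> k))"
      by (rule continuous_map_from_subtopology_mono) (use rk(2) in \<open>auto simp: preim_def\<close>)
    have "continuous_map ?X (gtop S) (\<lambda>x. \<beta> k (q x) \<cdot> \<phi> (\<rho> k) x)"
      using continuous_map_compose[OF q b] loc[OF k]
      by (intro continuous_mul \<phi>) (auto simp: o_def preim_def)
    moreover have "\<beta> k (q x) \<cdot> \<phi> (\<rho> k) x \<in> grestr S (V (\<sigma> k))" if "x \<in> topspace ?X" for x
      using loc[OF k, of x] that sk(2) by (auto simp: preim_def grestr_def)
    ultimately have "continuous_map ?X (subtopology (gtop S) (grestr S (V (\<sigma> k))))
        (\<lambda>x. \<beta> k (q x) \<cdot> \<phi> (\<rho> k) x)"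
      by (auto simp: continuous_map_in_subtopology)
    from continuous_map_compose[OF this continuous_chart_inv[OF T' sk(1)]] show ?thesis
      by (simp add: o_def f_def[abs_def] continuous_map_in_subtopology)
  qed
  have cover: "topspace X \<subseteq> (\<Union>k\<in>K. preim X q (W k))"
    using open_coverD(3)[OF W lch_space_overD(2)[OF X]] by (auto simp: preim_def)
  have agree': "f k x = f l x"
    if "k \<in> K" "l \<in> K" "x \<in> topspace X \<inter> preim X q (W k) \<inter> preim X q (W l)" for k l x
    using agree[of k l x] that by (simp add: preim_def)
  have op: "openin X (preim X q (W k))" if "k \<in> K" for k
    using openin_preim[OF X open_coverD(1)[OF W that]] .
  obtain \<Omega> where \<Omega>: "continuous_map X Y \<Omega>"
    "\<And>x k. k \<in> K \<Longrightarrow> x \<in> topspace X \<inter> preim X q (W k) \<Longrightarrow> \<Omega> x = f k x"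
    using pasting_lemma_exists[OF cover op cont agree'] by blast
  have \<Omega>f: "\<Omega> x = f k x" if "k \<in> K" "x \<in> topspace X" "q x \<in> W k" for x k
    using \<Omega>(2) that by (auto simp: preim_def)
  show thesis
  proof
    show "continuous_map X Y \<Omega>" by fact
    show "r (\<Omega> x) = q x" if x: "x \<in> topspace X" for x
      using open_coverD(3)[OF W lch_space_overD(2)[OF X x]] \<Omega>f x loc by fastforce
    show "\<psi> (\<sigma> k) (\<Omega> x) = \<beta> k (q x) \<cdot> \<phi> (\<rho> k) x"
      if "k \<in> K" "x \<in> topspace X" "q x \<in> W k" for k x
      using \<Omega>f[OF that] loc[OF that] by simp
  qed
qed

text \<open>The inverse cochain \<open>\<beta>'\<close> solves the reversed relation, so there are
  continuous maps in both directions. In charts each composite multiplies by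
  \<open>\<beta> k\<close> and its inverse, and charts are injective, so the maps are mutually
  inverse.\<close>

lemma cohomologous_iso:
  assumes T: "is_trivialization S X q ((I, U), \<phi>, \<gamma>)"
    and T': "is_trivialization S Y r ((J, V), \<psi>, \<eta>)"
    and X: "lch_space_over S X q" and Y: "lch_space_over S Y r"
    and coh: "cohomologous (I, U) \<gamma> (J, V) \<eta>"
  shows "\<exists>\<Xi>. is_iso S (X, q, (I, U), \<phi>, \<gamma>) (Y, r, (J, V), \<psi>, \<eta>) \<Xi>"
proof -
  obtain K W \<rho> \<sigma> \<beta> where W: "open_cover S (K, W)" and \<rho>: "refines_via (K, W) \<rho> (I, U)"
    and \<sigma>: "refines_via (K, W) \<sigma> (J, V)" and \<beta>: "\<beta> \<in> carrier (cochains0 S (K, W))"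
    and eq: "\<And>k l u. k \<in> K \<Longrightarrow> l \<in> K \<Longrightarrow> u \<in> W k \<Longrightarrow> u \<in> W l \<Longrightarrow>
        \<eta> (\<sigma> k, \<sigma> l) u = \<beta> k u \<cdot> iv (\<beta> l u) \<cdot> \<gamma> (\<rho> k, \<rho> l) u"
    using coh unfolding cohomologous_def by auto
  define \<beta>' where "\<beta>' = (\<lambda>k\<in>K. \<lambda>u\<in>W k. iv (\<beta> k u))"
  have \<beta>': "\<beta>' \<in> carrier (cochains0 S (K, W))"
    using \<beta> open_coverD(2)[OF W] by (auto simp: \<beta>'_def carrier_cochains0 intro!: section_iv)
  have eq': "\<gamma> (\<rho> k, \<rho> l) u = \<beta>' k u \<cdot> iv (\<beta>' l u) \<cdot> \<eta> (\<sigma> k, \<sigma> l) u"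
    if kl: "k \<in> K" "l \<in> K" and u: "u \<in> W k" "u \<in> W l" for k l u
  proof -
    have "u \<in> U (\<rho> k)" "u \<in> U (\<rho> l)"
      using refines_viaD[OF \<rho> kl(1)] refines_viaD[OF \<rho> kl(2)] u by auto
    note c = cochain1D[OF triv_cover[OF T] triv_cochain[OF T] refines_viaD(1)[OF \<rho> kl(1)]
        refines_viaD(1)[OF \<rho> kl(2)] this]
    note b = cochain0D[OF W \<beta> kl(1) u(1)] cochain0D[OF W \<beta> kl(2) u(2)]
    show ?thesis
      using b c kl u by (simp add: eq \<beta>'_def mul_assoc mul_lcomm[of "\<beta> l u" "\<beta> k u"])
  qed
  obtain \<Omega> where \<Omega>: "continuous_map X Y \<Omega>" and r: "\<And>x. x \<in> topspace X \<Longrightarrow> r (\<Omega> x) = q x"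
    and \<psi>: "\<And>k x. k \<in> K \<Longrightarrow> x \<in> topspace X \<Longrightarrow> q x \<in> W k \<Longrightarrow>
      \<psi> (\<sigma> k) (\<Omega> x) = \<beta> k (q x) \<cdot> \<phi> (\<rho> k) x"
    using cohomologous_map[OF T T' X W \<rho> \<sigma> \<beta> eq] by blast
  obtain \<Omega>' where \<Omega>': "continuous_map Y X \<Omega>'" and q: "\<And>y. y \<in> topspace Y \<Longrightarrow> q (\<Omega>' y) = r y"
    and \<phi>: "\<And>k y. k \<in> K \<Longrightarrow> y \<in> topspace Y \<Longrightarrow> r y \<in> W k \<Longrightarrow>
      \<phi> (\<rho> k) (\<Omega>' y) = \<beta>' k (r y) \<cdot> \<psi> (\<sigma> k) y"
    using cohomologous_map[OF T' T Y W \<sigma> \<rho> \<beta>' eq'] by blast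
  have Y1: "\<Omega> x \<in> topspace Y" if "x \<in> topspace X" for x
    using \<Omega> that by (auto simp: continuous_map_def)
  have X1: "\<Omega>' y \<in> topspace X" if "y \<in> topspace Y" for y
    using \<Omega>' that by (auto simp: continuous_map_def)
  have "\<Omega>' (\<Omega> x) = x" if x: "x \<in> topspace X" for x
  proof -
    obtain k where k: "k \<in> K" "q x \<in> W k"
      using open_coverD(3)[OF W lch_space_overD(2)[OF X x]] by blast
    note rk = refines_viaD[OF \<rho> k(1)]
    have U: "q x \<in> U (\<rho> k)"
      using rk k by blast
    note f = triv_G[OF T rk(1) x U] triv_p[OF T rk(1) x U] cochain0D[OF W \<beta> k]
    have "\<phi> (\<rho> k) (\<Omega>' (\<Omega> x)) = \<phi> (\<rho> k) x"
      using x k Y1 f by (simp add: \<phi> \<psi> r \<beta>'_def)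
    then show ?thesis
      using x U by (intro triv_inj[OF T rk(1)]) (simp_all add: Y1 X1 q r)
  qed
  moreover have "\<Omega> (\<Omega>' y) = y" if y: "y \<in> topspace Y" for y
  proof -
    obtain k where k: "k \<in> K" "r y \<in> W k"
      using open_coverD(3)[OF W lch_space_overD(2)[OF Y y]] by blast
    note sk = refines_viaD[OF \<sigma> k(1)]
    have V: "r y \<in> V (\<sigma> k)"
      using sk k by blast
    note f = triv_G[OF T' sk(1) y V] triv_p[OF T' sk(1) y V] cochain0D[OF W \<beta> k]
    have "\<psi> (\<sigma> k) (\<Omega> (\<Omega>' y)) = \<psi> (\<sigma> k) y"
      using y k X1 f by (simp add: \<phi> \<psi> q \<beta>'_def)
    then show ?thesis
      using y V by (intro triv_inj[OF T' sk(1)]) (simp_all add: Y1 X1 q r)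
  qed
  ultimately have "homeomorphic_maps X Y \<Omega> \<Omega>'"
    using \<Omega> \<Omega>' by (simp add: homeomorphic_maps_def)
  then have "homeomorphic_map X Y \<Omega>"
    using homeomorphic_map_maps by blast
  then have "is_iso S (X, q, (I, U), \<phi>, \<gamma>) (Y, r, (J, V), \<psi>, \<eta>) ((K, W), \<rho>, \<sigma>, \<Omega>, \<beta>)"
    unfolding is_iso_iff[OF T] using W \<rho> \<sigma> \<beta> r \<psi> by blast
  then show ?thesis
    by blast
qed

end


section \<open>Bundles glued from cocycles\<close>

text \<open>The topology is the final one for the maps \<open>\<theta> i\<close>.\<close>

lemma glued_topology_exists:
  assumes D: "\<And>i. i \<in> I \<Longrightarrow> openin Y (D i)"
    and \<theta>: "\<And>i. i \<in> I \<Longrightarrow> \<theta> i ` D i \<subseteq> M" and inj: "\<And>i. i \<in> I \<Longrightarrow> inj_on (\<theta> i) (D i)"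
    and cover: "M \<subseteq> (\<Union>i\<in>I. \<theta> i ` D i)"
    and \<tau>_dom: "\<And>i j. i \<in> I \<Longrightarrow> j \<in> I \<Longrightarrow> openin Y {s \<in> D j. \<theta> j s \<in> \<theta> i ` D i}"
    and \<tau>_cont: "\<And>i j. i \<in> I \<Longrightarrow> j \<in> I \<Longrightarrow>
      continuous_map (subtopology Y {s \<in> D j. \<theta> j s \<in> \<theta> i ` D i}) Y (\<tau> i j)"
    and \<tau>: "\<And>i j s. i \<in> I \<Longrightarrow> j \<in> I \<Longrightarrow> s \<in> D j \<Longrightarrow> \<theta> j s \<in> \<theta> i ` D i \<Longrightarrow>
      \<tau> i j s \<in> D i \<and> \<theta> i (\<tau> i j s) = \<theta> j s"
  obtains X where "topspace X = M" "\<And>i. i \<in> I \<Longrightarrow> openin X (\<theta> i ` D i)"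
    "\<And>i. i \<in> I \<Longrightarrow>
      homeomorphic_map (subtopology Y (D i)) (subtopology X (\<theta> i ` D i)) (\<theta> i)"
proof -
  let ?open = "\<lambda>A. A \<subseteq> M \<and> (\<forall>i\<in>I. openin Y {s \<in> D i. \<theta> i s \<in> A})"
  define X where "X = topology ?open"
  have "istopology ?open"
    unfolding istopology_def
  proof (intro conjI allI impI ballI)
    fix A B i assume AB: "?open A" "?open B" and i: "i \<in> I"
    have "{s \<in> D i. \<theta> i s \<in> A \<inter> B} = {s \<in> D i. \<theta> i s \<in> A} \<inter> {s \<in> D i. \<theta> i s \<in> B}"
      by blast
    then show "openin Y {s \<in> D i. \<theta> i s \<in> A \<inter> B}"
      using AB i by auto
  next
    fix \<A> i assume \<A>: "\<forall>A\<in>\<A>. ?open A" and i: "i \<in> I"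
    have "{s \<in> D i. \<theta> i s \<in> \<Union>\<A>} = (\<Union>A\<in>\<A>. {s \<in> D i. \<theta> i s \<in> A})"
      by blast
    then show "openin Y {s \<in> D i. \<theta> i s \<in> \<Union>\<A>}"
      using \<A> i by auto
  qed auto
  then have openX: "openin X = ?open"
    by (simp add: X_def)
  have "?open M"
  proof (intro conjI ballI)
    fix i assume i: "i \<in> I"
    have "{s \<in> D i. \<theta> i s \<in> M} = D i"
      using \<theta>[OF i] by blast
    then show "openin Y {s \<in> D i. \<theta> i s \<in> M}"
      using D[OF i] by simp
  qed simp
  then have top: "topspace X = M"
    using openin_subset[of X M] openin_topspace[of X] unfolding openX by blast
  have open_image: "openin X (\<theta> i ` B)" if i: "i \<in> I" and B: "openin Y B" "B \<subseteq> D i" for i B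
    unfolding openX
  proof (intro conjI ballI)
    show "\<theta> i ` B \<subseteq> M"
      using \<theta>[OF i] B by blast
    fix j assume j: "j \<in> I"
    let ?E = "{s \<in> D j. \<theta> j s \<in> \<theta> i ` D i}"
    \<comment> \<open>Injectivity of \<open>\<theta> i\<close> turns membership in an image into a
      condition on the transition map: seen from patch \<open>j\<close>, the image of
      \<open>B\<close> is the preimage of \<open>B\<close> under \<open>\<tau> i j\<close>. It is
      open in the overlap, and the overlap is open in \<open>Y\<close>.\<close>
    have "\<theta> j s \<in> \<theta> i ` B \<longleftrightarrow> \<tau> i j s \<in> B" if "s \<in> ?E" for s
    proof -
      have "\<tau> i j s \<in> D i" "\<theta> i (\<tau> i j s) = \<theta> j s"
        using \<tau>[OF i j] that by auto
      then show ?thesis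
        using inj_on_image_mem_iff[OF inj[OF i] _ B(2)] by metis
    qed
    then have "{s \<in> D j. \<theta> j s \<in> \<theta> i ` B} = {s \<in> topspace (subtopology Y ?E). \<tau> i j s \<in> B}"
      using B(2) openin_subset[OF D[OF j]] by auto
    then have "openin (subtopology Y ?E) {s \<in> D j. \<theta> j s \<in> \<theta> i ` B}"
      using openin_continuous_map_preimage[OF \<tau>_cont[OF i j] B(1)] by simp
    then show "openin Y {s \<in> D j. \<theta> j s \<in> \<theta> i ` B}"
      using openin_trans_full \<tau>_dom[OF i j] by blast
  qed
  have homeo: "homeomorphic_map (subtopology Y (D i)) (subtopology X (\<theta> i ` D i)) (\<theta> i)"
    if i: "i \<in> I" for i
  proof (rule bijective_open_imp_homeomorphic_map)
    have DY: "topspace (subtopology Y (D i)) = D i"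
      using openin_subset[OF D[OF i]] by auto
    show "continuous_map (subtopology Y (D i)) (subtopology X (\<theta> i ` D i)) (\<theta> i)"
      unfolding continuous_map_in_subtopology
    proof (intro conjI)
      show "continuous_map (subtopology Y (D i)) X (\<theta> i)"
        unfolding continuous_map DY
        using \<theta>[OF i] i by (auto simp: top openX openin_open_subtopology[OF D[OF i]])
    qed (use DY in auto)
    show "open_map (subtopology Y (D i)) (subtopology X (\<theta> i ` D i)) (\<theta> i)"
      unfolding open_map_def openin_open_subtopology[OF D[OF i]]
        openin_open_subtopology[OF open_image[OF i D[OF i] order_refl]]
      using open_image[OF i] by blast
    show "\<theta> i ` topspace (subtopology Y (D i)) = topspace (subtopology X (\<theta> i ` D i))"
      unfolding DY using \<theta>[OF i] top by auto
    show "inj_on (\<theta> i) (topspace (subtopology Y (D i)))"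
      unfolding DY using inj[OF i] .
  qed
  show thesis
    using that[OF top open_image[OF _ D order_refl] homeo] by blast
qed

section \<open>Local compactness and the Hausdorff property from patches\<close>

lemma locally_compact_space_open_cover:
  assumes "\<And>x. x \<in> topspace X \<Longrightarrow>
    \<exists>V. openin X V \<and> x \<in> V \<and> locally_compact_space (subtopology X V)"
  shows "locally_compact_space X"
  unfolding locally_compact_space_def
proof (intro ballI)
  fix x assume x: "x \<in> topspace X"
  then obtain V where V: "openin X V" "x \<in> V" "locally_compact_space (subtopology X V)"
    using assms by blast
  have "x \<in> topspace (subtopology X V)"
    using x V by simp
  then obtain A K where AK: "openin (subtopology X V) A" "compactin (subtopology X V) K" "x \<in> A" "A \<subseteq> K"
    using V(3) unfolding locally_compact_space_def by blast
  show "\<exists>A K. openin X A \<and> compactin X K \<and> x \<in> A \<and> A \<subseteq> K"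
    using openin_trans_full[OF AK(1) V(1)] AK by (intro exI[of _ A] exI[of _ K]) (simp add: compactin_subtopology)
qed

text \<open>Points over different base points are separated by preimages, points in one fibre inside
  a common Hausdorff open set. Asking for a set that contains both points excludes the line with two
  origins, which is locally Hausdorff over the line.\<close>

lemma Hausdorff_space_over:
  assumes q: "continuous_map X Z q" and Z: "Hausdorff_space Z"
    and loc: "\<And>x y. x \<in> topspace X \<Longrightarrow> y \<in> topspace X \<Longrightarrow> q x = q y \<Longrightarrow>
      \<exists>V. openin X V \<and> x \<in> V \<and> y \<in> V \<and> Hausdorff_space (subtopology X V)"
  shows "Hausdorff_space X"
  unfolding Hausdorff_space_def
proof (intro allI impI, elim conjE)
  fix x y assume xy: "x \<in> topspace X" "y \<in> topspace X" "x \<noteq> y"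
  show "\<exists>U V. openin X U \<and> openin X V \<and> x \<in> U \<and> y \<in> V \<and> disjnt U V"
  proof (cases "q x = q y")
    case True
    then obtain V where V: "openin X V" "x \<in> V" "y \<in> V" "Hausdorff_space (subtopology X V)"
      using loc xy by blast
    then have "\<exists>A B. openin (subtopology X V) A \<and> openin (subtopology X V) B \<and>
        x \<in> A \<and> y \<in> B \<and> disjnt A B"
      using xy unfolding Hausdorff_space_def by simp
    then show ?thesis
      using openin_trans_full[OF _ V(1)] by meson
  next
    case False
    have "q x \<in> topspace Z" "q y \<in> topspace Z"
      using q xy by (auto simp: continuous_map_def)
    then obtain A B where AB: "openin Z A" "openin Z B" "q x \<in> A" "q y \<in> B" "disjnt A B"
      using Z False unfolding Hausdorff_space_def by blast
    show ?thesis
    proof (intro exI conjI)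
      show "openin X {z \<in> topspace X. q z \<in> A}" "openin X {z \<in> topspace X. q z \<in> B}"
        using openin_continuous_map_preimage[OF q] AB by auto
    qed (use AB xy in \<open>auto simp: disjnt_iff\<close>)
  qed
qed

context ab_bundle
begin

lemma carrier_cocycles:
  "\<gamma> \<in> carrier (cocycles S (I, U)) \<longleftrightarrow> \<gamma> \<in> carrier (cochains1 S (I, U)) \<and>
    (\<forall>i\<in>I. \<forall>j\<in>I. \<forall>k\<in>I. \<forall>u \<in> U i \<inter> U j \<inter> U k.
          \<gamma> (i, j) u \<cdot> \<gamma> (j, k) u = \<gamma> (i, k) u)"
  by (simp add: cocycles_def)

text \<open>A trivialization only asks for a cochain of transition sections. The cocycle identity
  appears when the transitions are evaluated at the point whose coordinate in chart \<open>k\<close>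
  is the unit.\<close>

lemma triv_cocycle:
  assumes T: "is_trivialization S X q ((I, U), \<phi>, \<gamma>)"
  shows "\<gamma> \<in> carrier (cocycles S (I, U))"
  unfolding carrier_cocycles
proof (intro conjI ballI triv_cochain[OF T])
  fix i j k u assume ijk: "i \<in> I" "j \<in> I" "k \<in> I" and "u \<in> U i \<inter> U j \<inter> U k"
  then have u: "u \<in> U i" "u \<in> U j" "u \<in> U k" "u \<in> gunits S"
    using open_coverD(2)[OF triv_cover[OF T]] by blast+
  obtain x where x: "x \<in> topspace X" "q x = u" "\<phi> k x = u"
    using triv_surj[OF T ijk(3), of u] u by auto
  note c = cochain1D[OF triv_cover[OF T] triv_cochain[OF T]]
  note c = c[OF ijk(1,2) u(1,2)] c[OF ijk(2,3) u(2,3)] c[OF ijk(1,3) u(1,3)]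
  have "\<phi> i x = \<gamma> (i, k) u" "\<phi> j x = \<gamma> (j, k) u"
    using triv_trans[OF T ijk(1,3) x(1)] triv_trans[OF T ijk(2,3) x(1)] x u c by auto
  moreover have "\<phi> i x = \<gamma> (i, j) u \<cdot> \<phi> j x"
    using triv_trans[OF T ijk(1,2) x(1)] x u by simp
  ultimately show "\<gamma> (i, j) u \<cdot> \<gamma> (j, k) u = \<gamma> (i, k) u"
    by simp
qed

text \<open>Choosing an index \<open>c u\<close> for every unit \<open>u\<close> identifies the bundle glued from \<open>\<gamma>\<close> with the
  set \<open>S\<close> itself, fibre by fibre; only the topology differs. In these coordinates the inverse of
  the chart \<open>\<phi> i\<close> is \<open>s \<mapsto> \<gamma> (c u, i) u \<cdot> s\<close> for \<open>s\<close> in the fibre over \<open>u\<close>.\<close>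

lemma cocycle_realized:
  fixes e :: "'s \<Rightarrow> 'x"
  assumes e: "inj_on e (topspace (gtop S))"
    and cover: "open_cover S (I, U)" and \<gamma>: "\<gamma> \<in> carrier (cocycles S (I, U))"
  obtains X :: "'x topology" and q \<phi>
  where "lch_space_over S X q" "is_trivialization S X q ((I, U), \<phi>, \<gamma>)"
proof -
  define c where "c u = (SOME i. i \<in> I \<and> u \<in> U i)" for u
  have c: "c u \<in> I" "u \<in> U (c u)" if "u \<in> gunits S" for u
    using someI_ex[of "\<lambda>i. i \<in> I \<and> u \<in> U i"] open_coverD(3)[OF cover that] by (auto simp: c_def)
  have coch: "\<gamma> \<in> carrier (cochains1 S (I, U))"
    using \<gamma> by (simp add: carrier_cocycles)
  note \<gamma>1 = cochain1D[OF cover coch]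
  have \<gamma>2: "\<gamma> (i, j) u \<cdot> \<gamma> (j, k) u = \<gamma> (i, k) u"
    if "i \<in> I" "j \<in> I" "k \<in> I" "u \<in> U i" "u \<in> U j" "u \<in> U k" for i j k u
    using \<gamma> that by (simp add: carrier_cocycles)
  \<comment> \<open>The cocycle identity with three equal indices makes
    \<open>\<gamma> (i, i) u\<close> idempotent, and the only idempotent of a group is its
    unit.\<close>
  have \<gamma>3: "\<gamma> (i, i) u = u" if i: "i \<in> I" "u \<in> U i" for i u
  proof (rule mul_left_cancel[of "\<gamma> (i, i) u"])
    have "u \<in> gunits S"
      using open_coverD(2)[OF cover] that by blast
    then show "\<gamma> (i, i) u \<cdot> \<gamma> (i, i) u = \<gamma> (i, i) u \<cdot> u" "u \<in> G" "p (\<gamma> (i, i) u) = p u"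
      using \<gamma>2[of i i i u] \<gamma>1[of i i u] i by auto
  qed (use \<gamma>1[of i i u] i in auto)
  define D where "D i = grestr S (U i)" for i
  \<comment> \<open>The points are the copies \<open>e s\<close> of elements of \<open>S\<close>,
    and \<open>d\<close> reads them back. The maps \<open>\<theta> i\<close> and
    \<open>\<phi> i\<close> pass between coordinates in patch \<open>i\<close> and coordinates in
    the chosen patch \<open>c u\<close>.\<close>
  define d where "d = inv_into G e"
  define q where "q x = p (d x)" for x
  define \<theta> where "\<theta> i s = e (\<gamma> (c (p s), i) (p s) \<cdot> s)" for i s
  define \<phi> where "\<phi> i x = \<gamma> (i, c (q x)) (q x) \<cdot> d x" for i x
  define \<tau> where "\<tau> i j s = \<gamma> (i, j) (p s) \<cdot> s" for i j s
  have d_e: "d (e s) = s" if "s \<in> G" for s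
    using e that by (simp add: d_def)
  have D: "s \<in> D i \<longleftrightarrow> s \<in> G \<and> p s \<in> U i" for s i
    by (auto simp: D_def grestr_def)
  have \<theta>1: "\<theta> i s \<in> e ` G" "q (\<theta> i s) = p s" if "i \<in> I" "s \<in> D i" for i s
    using that c[of "p s"] \<gamma>1[of "c (p s)" i "p s"] by (auto simp: D \<theta>_def q_def d_e)
  \<comment> \<open>The chosen index \<open>c ?u\<close> cancels by the cocycle identity. The choice
    \<open>c\<close> may jump from unit to unit, but the transitions \<open>\<tau>\<close> do not
    see it, and only they need to be continuous.\<close>
  have \<phi>_\<theta>: "\<phi> i (\<theta> j s) = \<tau> i j s" if "i \<in> I" "j \<in> I" "s \<in> D i" "s \<in> D j" for i j s
  proof -
    let ?u = "p s"
    have s: "s \<in> G" "?u \<in> U i" "?u \<in> U j" "c ?u \<in> I" "?u \<in> U (c ?u)"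
      using that c[of "p s"] by (auto simp: D)
    have "\<phi> i (\<theta> j s) = \<gamma> (i, c ?u) ?u \<cdot> (\<gamma> (c ?u, j) ?u \<cdot> s)"
      using \<theta>1(2)[OF that(2,4)] \<gamma>1[of "c ?u" j ?u] that s by (simp add: \<phi>_def) (simp add: \<theta>_def d_e)
    also have "\<dots> = \<gamma> (i, j) ?u \<cdot> s"
      using \<gamma>1[of "c ?u" j ?u] \<gamma>1[of i "c ?u" ?u] \<gamma>2[of i "c ?u" j ?u] that s
      by (simp add: mul_assoc[symmetric])
    finally show ?thesis
      by (simp add: \<tau>_def)
  qed
  have \<phi>1: "\<phi> i x \<in> D i" "p (\<phi> i x) = q x" "\<theta> i (\<phi> i x) = x"
    if i: "i \<in> I" and x: "x \<in> e ` G" "q x \<in> U i" for i x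
  proof -
    obtain s where s: "s \<in> G" "x = e s"
      using x by blast
    have q: "q x = p s" "d x = s"
      using s by (simp_all add: q_def d_e)
    let ?u = "p s"
    have c': "c ?u \<in> I" "?u \<in> U (c ?u)" "?u \<in> U i"
      using s c[of ?u] x q by auto
    note g = \<gamma>1[OF c'(1) i c'(2,3)] \<gamma>1[OF i c'(1) c'(3,2)]
    show p: "p (\<phi> i x) = q x" and "\<phi> i x \<in> D i"
      using g s q c' by (auto simp: \<phi>_def D)
    show "\<theta> i (\<phi> i x) = x"
      using g s q c' i \<gamma>2[OF c'(1) i c'(1) c'(2,3,2)] \<gamma>3[OF c'(1,2)]
      unfolding \<theta>_def p by (simp add: \<phi>_def mul_assoc[symmetric])
  qed
  have image: "\<theta> i ` D i = {x \<in> e ` G. q x \<in> U i}" if "i \<in> I" for i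
  proof (intro equalityI subsetI)
    fix x assume "x \<in> {x \<in> e ` G. q x \<in> U i}"
    then show "x \<in> \<theta> i ` D i"
      using \<phi>1[OF that, of x] by (metis (mono_tags, lifting) image_eqI mem_Collect_eq)
  qed (use \<theta>1[OF that] in \<open>auto simp: D\<close>)
  have overlap: "{s \<in> D j. \<theta> j s \<in> \<theta> i ` D i} = grestr S (U i \<inter> U j)"
    if "i \<in> I" "j \<in> I" for i j
  proof -
    have "\<theta> j s \<in> \<theta> i ` D i \<longleftrightarrow> p s \<in> U i" if "s \<in> D j" for s
      using \<theta>1[OF \<open>j \<in> I\<close> that] by (simp add: image[OF \<open>i \<in> I\<close>])
    then show ?thesis
      by (auto simp: D grestr_def)
  qed
  have open_overlap: "openin (gtop S) (grestr S (U i \<inter> U j))" if "i \<in> I" "j \<in> I" for i j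
    using open_coverD(1)[OF cover] that by (intro openin_grestr) blast
  have \<tau>D: "\<tau> i j s \<in> D i \<and> \<theta> i (\<tau> i j s) = \<theta> j s"
    if ij: "i \<in> I" "j \<in> I" and s: "s \<in> D j" "\<theta> j s \<in> \<theta> i ` D i" for i j s
  proof -
    have "\<theta> j s \<in> e ` G" "q (\<theta> j s) \<in> U i" "s \<in> D i"
      using s ij \<theta>1[OF ij(2) s(1)] by (auto simp: image D)
    then show ?thesis
      using \<phi>1[OF ij(1), of "\<theta> j s"] \<phi>_\<theta>[OF ij, of s] s by simp
  qed
  have \<tau>_cont: "continuous_map (subtopology (gtop S) (grestr S (U i \<inter> U j))) (gtop S) (\<tau> i j)"
    if ij: "i \<in> I" "j \<in> I" for i j
  proof -
    let ?Y = "subtopology (gtop S) (grestr S (U i \<inter> U j))"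
    have "continuous_map ?Y (subtopology (unit_top S) (U i \<inter> U j)) p"
      using continuous_p
      by (auto simp: continuous_map_in_subtopology grestr_def intro: continuous_map_from_subtopology)
    moreover have "continuous_map (subtopology (unit_top S) (U i \<inter> U j)) (gtop S) (\<gamma> (i, j))"
      using coch ij by (auto simp: carrier_cochains1 carrier_sections)
    ultimately have "continuous_map ?Y (gtop S) (\<lambda>s. \<gamma> (i, j) (p s))"
      using continuous_map_compose by (fastforce simp: o_def)
    moreover have "continuous_map ?Y (gtop S) (\<lambda>s. s)"
      using continuous_map_from_subtopology[OF continuous_map_id] by (simp add: id_def)
    ultimately show ?thesis
      unfolding \<tau>_def[abs_def]
      by (rule continuous_mul) (use \<gamma>1[OF ij] in \<open>auto simp: grestr_def\<close>)
  qed
  have inj: "inj_on (\<theta> i) (D i)" if i: "i \<in> I" for i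
  proof (rule inj_on_inverseI)
    show "\<phi> i (\<theta> i s) = s" if "s \<in> D i" for s
      using \<phi>_\<theta>[OF i i that that] \<gamma>3[OF i] that by (auto simp: \<tau>_def D)
  qed
  have covers: "e ` G \<subseteq> (\<Union>i\<in>I. \<theta> i ` D i)"
  proof
    fix x assume x: "x \<in> e ` G"
    then have "q x \<in> gunits S"
      by (auto simp: q_def d_e)
    then show "x \<in> (\<Union>i\<in>I. \<theta> i ` D i)"
      using open_coverD(3)[OF cover] x by (auto simp: image)
  qed
  obtain X where X: "topspace X = e ` G"
    and op: "\<And>i. i \<in> I \<Longrightarrow> openin X (\<theta> i ` D i)"
    and homeo: "\<And>i. i \<in> I \<Longrightarrow>
      homeomorphic_map (subtopology (gtop S) (D i)) (subtopology X (\<theta> i ` D i)) (\<theta> i)"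
  proof (rule glued_topology_exists[of I "gtop S" D \<theta> "e ` G" \<tau>])
    show "openin (gtop S) (D i)" if "i \<in> I" for i
      unfolding D_def using open_coverD(1)[OF cover that] by (rule openin_grestr)
    show "\<theta> i ` D i \<subseteq> e ` G" if "i \<in> I" for i
      using image[OF that] by blast
    show "openin (gtop S) {s \<in> D j. \<theta> j s \<in> \<theta> i ` D i}" if "i \<in> I" "j \<in> I" for i j
      unfolding overlap[OF that] by (rule open_overlap[OF that])
    show "continuous_map (subtopology (gtop S) {s \<in> D j. \<theta> j s \<in> \<theta> i ` D i}) (gtop S) (\<tau> i j)"
      if "i \<in> I" "j \<in> I" for i j
      unfolding overlap[OF that] by (rule \<tau>_cont[OF that])
  qed (use inj covers \<tau>D in auto)
  have preim: "\<theta> i ` D i = preim X q (U i)" if "i \<in> I" for i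
    unfolding preim_def X image[OF that] ..
  have homeo': "homeomorphic_map (subtopology X (preim X q (U i)))
      (subtopology (gtop S) (grestr S (U i))) (\<phi> i)" if i: "i \<in> I" for i
  proof -
    obtain f where f: "homeomorphic_maps (subtopology (gtop S) (D i)) (subtopology X (\<theta> i ` D i)) (\<theta> i) f"
      using homeo[OF i] homeomorphic_map_maps by blast
    have "homeomorphic_map (subtopology X (\<theta> i ` D i)) (subtopology (gtop S) (D i)) f"
      using f homeomorphic_maps_sym homeomorphic_maps_imp_map by blast
    moreover have "f x = \<phi> i x" if "x \<in> topspace (subtopology X (\<theta> i ` D i))" for x
    proof -
      have "x \<in> \<theta> i ` D i"
        using that by (simp only: topspace_subtopology Int_iff)
      then obtain s where s: "s \<in> D i" "x = \<theta> i s"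
        by blast
      have "f (\<theta> i s) = s"
        using f s(1) by (auto simp: homeomorphic_maps_def D)
      then show ?thesis
        using s \<phi>_\<theta>[OF i i s(1,1)] \<gamma>3[OF i] by (auto simp: \<tau>_def D)
    qed
    ultimately show ?thesis
      using homeomorphic_map_eq unfolding D_def preim[OF i, unfolded D_def] by blast
  qed
  \<comment> \<open>On each patch \<open>q\<close> is \<open>p\<close> after the chart
    \<open>\<phi> i\<close>, so it is continuous there.\<close>
  have q_cont: "continuous_map X (unit_top S) q"
  proof (rule pasting_lemma[where I = I and T = "\<lambda>i. \<theta> i ` D i" and f = "\<lambda>i. q"])
    fix i assume i: "i \<in> I"
    show "openin X (\<theta> i ` D i)"
      using op[OF i] .
    have "continuous_map (subtopology X (\<theta> i ` D i)) (gtop S) (\<phi> i)"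
      using homeomorphic_imp_continuous_map[OF homeo'[OF i]]
      by (simp add: preim[OF i] continuous_map_in_subtopology)
    from continuous_map_compose[OF this continuous_p]
    show "continuous_map (subtopology X (\<theta> i ` D i)) (unit_top S) q"
      by (rule continuous_map_eq) (use \<phi>1(2)[OF i] in \<open>auto simp: preim[OF i] preim_def X\<close>)
  next
    show "\<exists>j. j \<in> I \<and> x \<in> \<theta> j ` D j \<and> q x = q x" if "x \<in> topspace X" for x
      using covers that unfolding X by blast
  qed simp
  have chart: "\<exists>i\<in>I. q x \<in> U i" if "x \<in> topspace X" for x
    using open_coverD(3)[OF cover, of "q x"] q_cont that by (auto simp: continuous_map_def)
  have homeo_space: "subtopology X (\<theta> i ` D i) homeomorphic_space subtopology (gtop S) (D i)"
    if "i \<in> I" for i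
    using homeo[OF that] homeomorphic_map_imp_homeomorphic_space homeomorphic_space_sym by blast
  have "locally_compact_space X"
  proof (rule locally_compact_space_open_cover)
    fix x assume x: "x \<in> topspace X"
    then obtain i where i: "i \<in> I" "q x \<in> U i"
      using chart by blast
    have "locally_compact_space (subtopology (gtop S) (D i))"
      unfolding D_def using locally_compact Hausdorff openin_grestr[OF open_coverD(1)[OF cover i(1)]]
      by (intro locally_compact_space_open_subset) auto
    then have "locally_compact_space (subtopology X (\<theta> i ` D i))"
      using homeomorphic_locally_compact_space[OF homeo_space[OF i(1)]] by simp
    then show "\<exists>V. openin X V \<and> x \<in> V \<and> locally_compact_space (subtopology X V)"
      using op[OF i(1)] x i X by (intro exI[of _ "\<theta> i ` D i"]) (simp add: image)
  qed
  moreover have "Hausdorff_space X"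
  proof (rule Hausdorff_space_over[OF q_cont])
    show "Hausdorff_space (unit_top S)"
      unfolding unit_top_def using Hausdorff by (rule Hausdorff_space_subtopology)
    fix x y assume xy: "x \<in> topspace X" "y \<in> topspace X" "q x = q y"
    then obtain i where i: "i \<in> I" "q x \<in> U i"
      using chart by blast
    \<comment> \<open>A patch is the full preimage of \<open>U i\<close> under \<open>q\<close>, so
      the patch around \<open>x\<close> contains every point of its fibre, in particular
      \<open>y\<close>.\<close>
    have "Hausdorff_space (subtopology X (\<theta> i ` D i))"
      using homeomorphic_Hausdorff_space[OF homeo_space[OF i(1)]] Hausdorff
      by (simp add: Hausdorff_space_subtopology)
    then show "\<exists>V. openin X V \<and> x \<in> V \<and> y \<in> V \<and> Hausdorff_space (subtopology X V)"
      using op[OF i(1)] xy i X by (intro exI[of _ "\<theta> i ` D i"]) (simp add: image)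
  qed
  moreover have "q ` topspace X = gunits S"
    unfolding X image_image q_def gunits_def by (intro image_cong refl) (simp add: d_e)
  ultimately have "lch_space_over S X q"
    using q_cont by (simp add: lch_space_over_def)
  moreover have "is_trivialization S X q ((I, U), \<phi>, \<gamma>)"
  proof (rule is_trivializationI[OF cover coch homeo'])
    fix i x assume "i \<in> I" "x \<in> topspace X" "q x \<in> U i"
    then show "p (\<phi> i x) = q x"
      using \<phi>1 X by simp
  next
    fix i j x assume ij: "i \<in> I" "j \<in> I" and x: "x \<in> topspace X" "q x \<in> U i" "q x \<in> U j"
    have \<phi>j: "\<phi> j x \<in> D j" "p (\<phi> j x) = q x" "\<theta> j (\<phi> j x) = x"
      using \<phi>1[OF ij(2)] x X by auto
    then have "\<phi> j x \<in> D i"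
      using x by (simp add: D)
    then have "\<phi> i (\<theta> j (\<phi> j x)) = \<gamma> (i, j) (p (\<phi> j x)) \<cdot> \<phi> j x"
      using \<phi>_\<theta>[OF ij _ \<phi>j(1)] by (simp add: \<tau>_def)
    then show "\<phi> i x = \<gamma> (i, j) (q x) \<cdot> \<phi> j x"
      unfolding \<phi>j(2,3) .
  qed
  ultimately show thesis
    using that by blast
qed


section \<open>Cosets of boundaries and the direct limit\<close>

text \<open>The action of 0-cochains on 1-cochains by multiplication with the coboundary. Cosets of
  boundaries are its orbits, which reduces coset arithmetic to pointwise identities.\<close>

definition twist ::
    "('i, 's) cover \<Rightarrow> ('i \<Rightarrow> 's \<Rightarrow> 's) \<Rightarrow> ('i \<times> 'i \<Rightarrow> 's \<Rightarrow> 's) \<Rightarrow> 'i \<times> 'i \<Rightarrow> 's \<Rightarrow> 's" where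
  "twist = (\<lambda>(K, W) \<beta> \<gamma>. \<lambda>(k, l)\<in>K \<times> K. \<lambda>u\<in>W k \<inter> W l. \<beta> k u \<cdot> iv (\<beta> l u) \<cdot> \<gamma> (k, l) u)"

lemma coboundary_mult:
  "coboundary S (K, W) \<beta> \<otimes>\<^bsub>cocycles S (K, W)\<^esub> \<gamma> = twist (K, W) \<beta> \<gamma>"
  by (auto simp: coboundary_def cocycles_def cochains1_def sections_def twist_def fun_eq_iff
    restrict_def)

lemma boundaries_coset:
  "boundaries S (K, W) #>\<^bsub>cocycles S (K, W)\<^esub> \<gamma> =
    (\<lambda>\<beta>. twist (K, W) \<beta> \<gamma>) ` carrier (cochains0 S (K, W))"
  by (auto simp: r_coset_def boundaries_def coboundary_mult)

lemma boundaries_set_mult: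
  "boundaries S (K, W) <#>\<^bsub>cocycles S (K, W)\<^esub> A =
    {twist (K, W) \<beta> a | \<beta> a. \<beta> \<in> carrier (cochains0 S (K, W)) \<and> a \<in> A}"
  by (auto simp: set_mult_def boundaries_def coboundary_mult)

lemma cochains0_mul:
  assumes W: "open_cover S (K, W)"
    and "\<beta> \<in> carrier (cochains0 S (K, W))" "\<beta>' \<in> carrier (cochains0 S (K, W))"
  shows "(\<lambda>k\<in>K. \<lambda>u\<in>W k. \<beta> k u \<cdot> \<beta>' k u) \<in> carrier (cochains0 S (K, W))"
  using assms open_coverD(2)[OF W] by (auto simp: carrier_cochains0 intro!: section_mul)

lemma cochains0_iv:
  assumes W: "open_cover S (K, W)" and "\<beta> \<in> carrier (cochains0 S (K, W))"
  shows "(\<lambda>k\<in>K. \<lambda>u\<in>W k. iv (\<beta> k u)) \<in> carrier (cochains0 S (K, W))"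
  using assms open_coverD(2)[OF W] by (auto simp: carrier_cochains0 intro!: section_iv)

lemma cochains0_unit:
  assumes W: "open_cover S (K, W)"
  shows "(\<lambda>k\<in>K. \<lambda>u\<in>W k. u) \<in> carrier (cochains0 S (K, W))"
  using open_coverD(2)[OF W] by (auto simp: carrier_cochains0 intro!: section_unit)

lemma cochains0_pull:
  assumes "refines_via (K, W) \<rho> (I, U)" "\<beta> \<in> carrier (cochains0 S (I, U))"
  shows "(\<lambda>k\<in>K. restrict (\<beta> (\<rho> k)) (W k)) \<in> carrier (cochains0 S (K, W))"
  using assms refines_viaD[OF assms(1)]
  by (auto simp: carrier_cochains0 intro!: section_restrict[of "\<beta> (\<rho> _)" "U (\<rho> _)"])

lemma cochains1_pull:
  assumes "refines_via (K, W) \<rho> (I, U)" "\<gamma> \<in> carrier (cochains1 S (I, U))"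
  shows "pull_cochain (K, W) \<rho> \<gamma> \<in> carrier (cochains1 S (K, W))"
  unfolding carrier_cochains1
proof (intro conjI ballI)
  fix k l assume kl: "k \<in> K" "l \<in> K"
  have "restrict (\<gamma> (\<rho> k, \<rho> l)) (W k \<inter> W l) \<in> carrier (sections S (W k \<inter> W l))"
    using refines_viaD[OF assms(1) kl(1)] refines_viaD[OF assms(1) kl(2)] assms(2)
    by (intro section_restrict[of _ "U (\<rho> k) \<inter> U (\<rho> l)"]) (auto simp: carrier_cochains1)
  then show "pull_cochain (K, W) \<rho> \<gamma> (k, l) \<in> carrier (sections S (W k \<inter> W l))"
    using kl by (simp add: pull_cochain_def restrict_def)
qed (simp add: pull_cochain_def)

lemma cochains1_eqI:
  assumes "\<gamma> \<in> carrier (cochains1 S (K, W))" "\<eta> \<in> carrier (cochains1 S (K, W))"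
    and "\<And>k l u. k \<in> K \<Longrightarrow> l \<in> K \<Longrightarrow> u \<in> W k \<Longrightarrow> u \<in> W l \<Longrightarrow> \<gamma> (k, l) u = \<eta> (k, l) u"
  shows "\<gamma> = \<eta>"
proof (rule extensionalityI[of _ "K \<times> K"])
  fix kl assume "kl \<in> K \<times> K"
  then obtain k l where kl: "kl = (k, l)" "k \<in> K" "l \<in> K"
    by blast
  show "\<gamma> kl = \<eta> kl"
    unfolding kl(1) using assms kl
    by (intro extensionalityI[of _ "W k \<inter> W l"]) (auto simp: carrier_cochains1 carrier_sections)
qed (use assms in \<open>auto simp: carrier_cochains1\<close>)

lemma twist_closed:
  assumes W: "open_cover S (K, W)" and \<beta>: "\<beta> \<in> carrier (cochains0 S (K, W))"
    and \<gamma>: "\<gamma> \<in> carrier (cochains1 S (K, W))"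
  shows "twist (K, W) \<beta> \<gamma> \<in> carrier (cochains1 S (K, W))"
  unfolding carrier_cochains1
proof (intro conjI ballI)
  fix k l assume kl: "k \<in> K" "l \<in> K"
  let ?A = "W k \<inter> W l"
  have A: "?A \<subseteq> gunits S"
    using open_coverD(2)[OF W kl(1)] by blast
  have b: "restrict (\<beta> m) ?A \<in> carrier (sections S ?A)" if "m \<in> {k, l}" for m
    using \<beta> kl that by (intro section_restrict[of _ "W m"]) (auto simp: carrier_cochains0)
  have g: "\<gamma> (k, l) \<in> carrier (sections S ?A)"
    using \<gamma> kl by (auto simp: carrier_cochains1)
  \<comment> \<open>The nested restrictions give the literal shape that the closure rules for
    products and inverses of sections produce; on \<open>?A\<close> they have no effect.\<close>
  have "(\<lambda>u\<in>?A. (\<lambda>u\<in>?A. restrict (\<beta> k) ?A u \<cdot> (\<lambda>u\<in>?A. iv (restrict (\<beta> l) ?A u)) u) u \<cdot> \<gamma> (k, l) u)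
      \<in> carrier (sections S ?A)"
    by (intro section_mul section_iv A g b insertI1 insertI2)
  also have "(\<lambda>u\<in>?A. (\<lambda>u\<in>?A. restrict (\<beta> k) ?A u \<cdot> (\<lambda>u\<in>?A. iv (restrict (\<beta> l) ?A u)) u) u \<cdot>
      \<gamma> (k, l) u) = twist (K, W) \<beta> \<gamma> (k, l)"
    using kl by (auto simp: twist_def)
  finally show "twist (K, W) \<beta> \<gamma> (k, l) \<in> carrier (sections S ?A)" .
qed (simp add: twist_def)

lemma twist_apply:
  "k \<in> K \<Longrightarrow> l \<in> K \<Longrightarrow> u \<in> W k \<Longrightarrow> u \<in> W l \<Longrightarrow>
    twist (K, W) \<beta> \<gamma> (k, l) u = \<beta> k u \<cdot> iv (\<beta> l u) \<cdot> \<gamma> (k, l) u"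
  by (simp add: twist_def)

text \<open>The composition law of the action. It rests on commutativity, which lets the factors at
  \<open>k\<close> and the inverted factors at \<open>l\<close> be gathered.\<close>

lemma twist_twist:
  assumes W: "open_cover S (K, W)" and \<beta>: "\<beta> \<in> carrier (cochains0 S (K, W))"
    and \<beta>': "\<beta>' \<in> carrier (cochains0 S (K, W))" and \<gamma>: "\<gamma> \<in> carrier (cochains1 S (K, W))"
  shows "twist (K, W) \<beta>' (twist (K, W) \<beta> \<gamma>) =
    twist (K, W) (\<lambda>k\<in>K. \<lambda>u\<in>W k. \<beta>' k u \<cdot> \<beta> k u) \<gamma>"
proof (rule cochains1_eqI)
  fix k l u assume kl: "k \<in> K" "l \<in> K" and u: "u \<in> W k" "u \<in> W l"
  note b = cochain0D[OF W \<beta> kl(1) u(1)] cochain0D[OF W \<beta> kl(2) u(2)]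
    cochain0D[OF W \<beta>' kl(1) u(1)] cochain0D[OF W \<beta>' kl(2) u(2)]
    cochain1D[OF W \<gamma> kl u]
  show "twist (K, W) \<beta>' (twist (K, W) \<beta> \<gamma>) (k, l) u =
      twist (K, W) (\<lambda>k\<in>K. \<lambda>u\<in>W k. \<beta>' k u \<cdot> \<beta> k u) \<gamma> (k, l) u"
    using kl u b
    by (simp add: twist_apply iv_mul_distrib mul_assoc mul_lcomm[of "iv (\<beta>' l u)" "\<beta> k u"])
qed (use assms in \<open>auto intro!: twist_closed cochains0_mul\<close>)

lemma twist_unit:
  assumes W: "open_cover S (K, W)" and \<gamma>: "\<gamma> \<in> carrier (cochains1 S (K, W))"
  shows "twist (K, W) (\<lambda>k\<in>K. \<lambda>u\<in>W k. u) \<gamma> = \<gamma>"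
proof (rule cochains1_eqI)
  fix k l u assume kl: "k \<in> K" "l \<in> K" and u: "u \<in> W k" "u \<in> W l"
  have "u \<in> gunits S"
    using open_coverD(2)[OF W kl(1)] u by blast
  then show "twist (K, W) (\<lambda>k\<in>K. \<lambda>u\<in>W k. u) \<gamma> (k, l) u = \<gamma> (k, l) u"
    using kl u cochain1D[OF W \<gamma> kl u] by (simp add: twist_apply)
qed (use assms in \<open>auto intro!: twist_closed cochains0_unit\<close>)

lemma boundaries_coset_subset:
  assumes W: "open_cover S (K, W)" and \<beta>: "\<beta> \<in> carrier (cochains0 S (K, W))"
    and \<gamma>: "\<gamma> \<in> carrier (cochains1 S (K, W))"
  shows "boundaries S (K, W) #>\<^bsub>cocycles S (K, W)\<^esub> twist (K, W) \<beta> \<gamma> \<subseteq>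
    boundaries S (K, W) #>\<^bsub>cocycles S (K, W)\<^esub> \<gamma>"
  unfolding boundaries_coset using twist_twist[OF W \<beta> _ \<gamma>] cochains0_mul[OF W _ \<beta>] by auto

text \<open>An orbit contains its base point, via the cochain of units, so equal orbits give a
  \<open>\<beta>\<close>. Conversely the inverse cochain undoes the twist, and the inclusion of
  orbits applies both ways.\<close>

lemma boundaries_coset_eq_iff:
  assumes W: "open_cover S (K, W)"
    and \<gamma>: "\<gamma> \<in> carrier (cochains1 S (K, W))" and \<eta>: "\<eta> \<in> carrier (cochains1 S (K, W))"
  shows "boundaries S (K, W) #>\<^bsub>cocycles S (K, W)\<^esub> \<gamma> =
      boundaries S (K, W) #>\<^bsub>cocycles S (K, W)\<^esub> \<eta> \<longleftrightarrow>
    (\<exists>\<beta>\<in>carrier (cochains0 S (K, W)). \<eta> = twist (K, W) \<beta> \<gamma>)" (is "?L = ?R \<longleftrightarrow> ?E")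
proof
  assume "?L = ?R"
  moreover have "\<eta> \<in> ?R"
    unfolding boundaries_coset using twist_unit[OF W \<eta>] cochains0_unit[OF W] by force
  ultimately show ?E
    unfolding boundaries_coset by auto
next
  assume ?E
  then obtain \<beta> where \<beta>: "\<beta> \<in> carrier (cochains0 S (K, W))" and eq: "\<eta> = twist (K, W) \<beta> \<gamma>"
    by blast
  let ?\<beta>' = "\<lambda>k\<in>K. \<lambda>u\<in>W k. iv (\<beta> k u)"
  have \<beta>': "?\<beta>' \<in> carrier (cochains0 S (K, W))"
    using cochains0_iv[OF W \<beta>] .
  have "twist (K, W) ?\<beta>' \<eta> = \<gamma>"
    unfolding eq
  proof (rule cochains1_eqI)
    fix k l u assume kl: "k \<in> K" "l \<in> K" and u: "u \<in> W k" "u \<in> W l"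
    note b = cochain0D[OF W \<beta> kl(1) u(1)] cochain0D[OF W \<beta> kl(2) u(2)] cochain1D[OF W \<gamma> kl u]
    show "twist (K, W) ?\<beta>' (twist (K, W) \<beta> \<gamma>) (k, l) u = \<gamma> (k, l) u"
      using kl u b by (simp add: twist_apply mul_assoc mul_lcomm[of "\<beta> l u" "\<beta> k u"])
  qed (use W \<beta> \<beta>' \<gamma> in \<open>auto intro!: twist_closed\<close>)
  then show "?L = ?R"
    using boundaries_coset_subset[OF W \<beta> \<gamma>] boundaries_coset_subset[OF W \<beta>' \<eta>] eq by auto
qed

text \<open>Pulling back a twist by \<open>\<beta>\<close> is twisting the pullback by the
  restriction of \<open>\<beta>\<close> along \<open>\<rho>\<close>. So all members of a coset pull
  back into one coset, and multiplying by the boundaries of the finer cover fills it up.\<close>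

lemma pull_class_coset:
  assumes U: "open_cover S (I, U)" and W: "open_cover S (K, W)"
    and \<rho>: "refines_via (K, W) \<rho> (I, U)" and \<gamma>: "\<gamma> \<in> carrier (cochains1 S (I, U))"
  shows "pull_class S (K, W) \<rho> (boundaries S (I, U) #>\<^bsub>cocycles S (I, U)\<^esub> \<gamma>) =
    boundaries S (K, W) #>\<^bsub>cocycles S (K, W)\<^esub> pull_cochain (K, W) \<rho> \<gamma>" (is "?L = ?R")
proof -
  let ?pull = "pull_cochain (K, W) \<rho>"
  let ?res = "\<lambda>\<beta>. \<lambda>k\<in>K. restrict (\<beta> (\<rho> k)) (W k)"
  have pull: "?pull (twist (I, U) \<beta> \<gamma>) = twist (K, W) (?res \<beta>) (?pull \<gamma>)"
    if \<beta>: "\<beta> \<in> carrier (cochains0 S (I, U))" for \<beta>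
  proof (rule cochains1_eqI)
    fix k l u assume kl: "k \<in> K" "l \<in> K" and u: "u \<in> W k" "u \<in> W l"
    have "u \<in> U (\<rho> k)" "u \<in> U (\<rho> l)"
      using refines_viaD[OF \<rho> kl(1)] refines_viaD[OF \<rho> kl(2)] u by auto
    then show "?pull (twist (I, U) \<beta> \<gamma>) (k, l) u = twist (K, W) (?res \<beta>) (?pull \<gamma>) (k, l) u"
      using kl u refines_viaD(1)[OF \<rho>] by (simp add: twist_apply pull_cochain_def)
  qed (use U W \<rho> \<gamma> \<beta> in \<open>auto intro!: twist_closed cochains1_pull cochains0_pull\<close>)
  have L: "?L = {twist (K, W) \<beta>' (?pull (twist (I, U) \<beta> \<gamma>)) | \<beta>' \<beta>.
      \<beta>' \<in> carrier (cochains0 S (K, W)) \<and> \<beta> \<in> carrier (cochains0 S (I, U))}"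
    unfolding pull_class_def boundaries_set_mult boundaries_coset by auto
  note c = cochains1_pull[OF \<rho> \<gamma>]
  show ?thesis
  proof
    show "?L \<subseteq> ?R"
      unfolding L
    proof clarify
      fix \<beta>' \<beta> assume \<beta>': "\<beta>' \<in> carrier (cochains0 S (K, W))"
        and \<beta>: "\<beta> \<in> carrier (cochains0 S (I, U))"
      show "twist (K, W) \<beta>' (?pull (twist (I, U) \<beta> \<gamma>)) \<in> ?R"
        using boundaries_coset_subset[OF W cochains0_pull[OF \<rho> \<beta>] c] \<beta>'
        unfolding pull[OF \<beta>] boundaries_coset by blast
    qed
    have "?pull (twist (I, U) (\<lambda>i\<in>I. \<lambda>u\<in>U i. u) \<gamma>) = ?pull \<gamma>"
      using twist_unit[OF U \<gamma>] by simp
    then show "?R \<subseteq> ?L"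
      unfolding L unfolding boundaries_coset using cochains0_unit[OF U] by force
  qed
qed

lemma pull_classes_agree_iff:
  assumes U: "open_cover S (I, U)" and V: "open_cover S (J, V)" and W: "open_cover S (K, W)"
    and \<rho>: "refines_via (K, W) \<rho> (I, U)" and \<gamma>: "\<gamma> \<in> carrier (cochains1 S (I, U))"
    and \<sigma>: "refines_via (K, W) \<sigma> (J, V)" and \<eta>: "\<eta> \<in> carrier (cochains1 S (J, V))"
  shows "pull_class S (K, W) \<rho> (boundaries S (I, U) #>\<^bsub>cocycles S (I, U)\<^esub> \<gamma>) =
      pull_class S (K, W) \<sigma> (boundaries S (J, V) #>\<^bsub>cocycles S (J, V)\<^esub> \<eta>) \<longleftrightarrow>
    (\<exists>\<beta>\<in>carrier (cochains0 S (K, W)). \<forall>k\<in>K. \<forall>l\<in>K. \<forall>u\<in>W k \<inter> W l.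
        \<eta> (\<sigma> k, \<sigma> l) u = \<beta> k u \<cdot> iv (\<beta> l u) \<cdot> \<gamma> (\<rho> k, \<rho> l) u)"
proof -
  have "pull_cochain (K, W) \<sigma> \<eta> = twist (K, W) \<beta> (pull_cochain (K, W) \<rho> \<gamma>) \<longleftrightarrow>
      (\<forall>k\<in>K. \<forall>l\<in>K. \<forall>u\<in>W k \<inter> W l.
        \<eta> (\<sigma> k, \<sigma> l) u = \<beta> k u \<cdot> iv (\<beta> l u) \<cdot> \<gamma> (\<rho> k, \<rho> l) u)" (is "?L \<longleftrightarrow> ?R")
    if \<beta>: "\<beta> \<in> carrier (cochains0 S (K, W))" for \<beta>
  proof
    assume L: ?L
    show ?R
    proof (intro ballI)
      fix k l u assume "k \<in> K" "l \<in> K" "u \<in> W k \<inter> W l"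
      then show "\<eta> (\<sigma> k, \<sigma> l) u = \<beta> k u \<cdot> iv (\<beta> l u) \<cdot> \<gamma> (\<rho> k, \<rho> l) u"
        using fun_cong[OF fun_cong[OF L, of "(k, l)"], of u]
        by (simp add: twist_apply pull_cochain_def)
    qed
  next
    assume ?R
    then show ?L
      using W \<rho> \<sigma> \<gamma> \<eta> \<beta> by (intro cochains1_eqI[of _ K W] twist_closed cochains1_pull)
        (auto simp: twist_apply pull_cochain_def)
  qed
  then show ?thesis
    unfolding pull_class_coset[OF U W \<rho> \<gamma>] pull_class_coset[OF V W \<sigma> \<eta>]
      boundaries_coset_eq_iff[OF W cochains1_pull[OF \<rho> \<gamma>] cochains1_pull[OF \<sigma> \<eta>]]
    by (rule bex_cong[OF refl])
qed

section \<open>The relation of the direct limit in terms of cocycles\<close>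

lemma local_classes_iff:
  "a \<in> local_classes S \<longleftrightarrow> (\<exists>I U \<gamma>. a = ((I, U), boundaries S (I, U) #>\<^bsub>cocycles S (I, U)\<^esub> \<gamma>) \<and>
    open_cover S (I, U) \<and> \<gamma> \<in> carrier (cocycles S (I, U)))"
  by (auto simp: local_classes_def cech_H1_def carrier_FactGroup)

lemma limit_rel_iff:
  assumes U: "open_cover S (I, U)" "\<gamma> \<in> carrier (cocycles S (I, U))"
    and V: "open_cover S (J, V)" "\<eta> \<in> carrier (cocycles S (J, V))"
  shows "(((I, U), boundaries S (I, U) #>\<^bsub>cocycles S (I, U)\<^esub> \<gamma>),
      ((J, V), boundaries S (J, V) #>\<^bsub>cocycles S (J, V)\<^esub> \<eta>)) \<in> limit_rel S \<longleftrightarrow>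
    cohomologous (I, U) \<gamma> (J, V) \<eta>"
proof -
  have "((I, U), boundaries S (I, U) #>\<^bsub>cocycles S (I, U)\<^esub> \<gamma>) \<in> local_classes S"
    "((J, V), boundaries S (J, V) #>\<^bsub>cocycles S (J, V)\<^esub> \<eta>) \<in> local_classes S"
    using assms unfolding local_classes_iff by blast+
  moreover have "\<gamma> \<in> carrier (cochains1 S (I, U))" "\<eta> \<in> carrier (cochains1 S (J, V))"
    using assms by (auto simp: carrier_cocycles)
  note pull_classes_agree_iff[OF U(1) V(1) _ _ this(1) _ this(2)]
  ultimately show ?thesis
    unfolding limit_rel_def cohomologous_def by (auto simp: split_paired_Ex) blast+
qed


section \<open>Characteristic classes\<close>

lemma cohomologous_trans:
  fixes g :: "'s set \<Rightarrow> 'i" and I J L :: "'i set"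
  assumes g: "inj_on g {U. openin (unit_top S) U}"
    and \<gamma>: "open_cover S (I, U)" "\<gamma> \<in> carrier (cocycles S (I, U))"
    and \<eta>: "open_cover S (J, V)" "\<eta> \<in> carrier (cocycles S (J, V))"
    and \<zeta>: "open_cover S (L, Z)" "\<zeta> \<in> carrier (cocycles S (L, Z))"
    and 1: "cohomologous (I, U) \<gamma> (J, V) \<eta>" and 2: "cohomologous (J, V) \<eta> (L, Z) \<zeta>"
  shows "cohomologous (I, U) \<gamma> (L, Z) \<zeta>"
proof -
  \<comment> \<open>The auxiliary bundles take their points from \<open>'s\<close>, with the
    identity as embedding.\<close>
  have id: "inj_on (\<lambda>s. s) G"
    by simp
  obtain X :: "'s topology" and q \<phi>
    where X: "lch_space_over S X q" and T: "is_trivialization S X q ((I, U), \<phi>, \<gamma>)"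
    using cocycle_realized[OF id \<gamma>] by blast
  obtain Y :: "'s topology" and r \<psi>
    where Y: "lch_space_over S Y r" and T': "is_trivialization S Y r ((J, V), \<psi>, \<eta>)"
    using cocycle_realized[OF id \<eta>] by blast
  obtain M :: "'s topology" and t \<xi>
    where M: "lch_space_over S M t" and T'': "is_trivialization S M t ((L, Z), \<xi>, \<zeta>)"
    using cocycle_realized[OF id \<zeta>] by blast
  obtain W \<rho> \<sigma> \<Omega> \<beta>
    where iso1: "is_iso S (X, q, (I, U), \<phi>, \<gamma>) (Y, r, (J, V), \<psi>, \<eta>) (W, \<rho>, \<sigma>, \<Omega>, \<beta>)"
    using cohomologous_iso[OF T T' X Y 1] by auto
  obtain W' \<rho>' \<sigma>' \<Omega>' \<beta>'
    where iso2: "is_iso S (Y, r, (J, V), \<psi>, \<eta>) (M, t, (L, Z), \<xi>, \<zeta>) (W', \<rho>', \<sigma>', \<Omega>', \<beta>')"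
    using cohomologous_iso[OF T' T'' Y M 2] by auto
  obtain K W1 K' W2 where W: "W = (K, W1)" "W' = (K', W2)"
    by fastforce
  note iso1 = iso1[unfolded W] and iso2 = iso2[unfolded W]
  have \<Omega>: "homeomorphic_map X Y \<Omega>" "\<And>x. x \<in> topspace X \<Longrightarrow> r (\<Omega> x) = q x"
    using iso1 unfolding is_iso_iff[OF T] by auto
  have \<Omega>': "homeomorphic_map Y M \<Omega>'" "\<And>y. y \<in> topspace Y \<Longrightarrow> t (\<Omega>' y) = r y"
    using iso2 unfolding is_iso_iff[OF T'] by auto
  have \<Omega>Y: "\<Omega> x \<in> topspace Y" if "x \<in> topspace X" for x
    using homeomorphic_imp_surjective_map[OF \<Omega>(1)] that by auto
  \<comment> \<open>The refinements and sections of the two isomorphisms are discarded here;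
    \<open>preserves_ratios_iso\<close> supplies new ones for the composite.\<close>
  have "preserves_ratios X q ((I, U), \<phi>, \<gamma>) ((L, Z), \<xi>, \<zeta>) (\<Omega>' \<circ> \<Omega>)"
    using \<Omega> \<Omega>Y by (intro preserves_ratios_compose[OF T' X _ iso_preserves_ratios[OF T T' X iso1]
        iso_preserves_ratios[OF T' T'' Y iso2]]) auto
  moreover have "homeomorphic_map X M (\<Omega>' \<circ> \<Omega>)"
    using \<Omega>(1) \<Omega>'(1) by (rule homeomorphic_map_compose)
  ultimately obtain W'' \<rho>'' \<sigma>'' \<beta>'' where
    "is_iso S (X, q, (I, U), \<phi>, \<gamma>) (M, t, (L, Z), \<xi>, \<zeta>) (W'', \<rho>'', \<sigma>'', \<Omega>' \<circ> \<Omega>, \<beta>'')"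
    using preserves_ratios_iso[OF g T T''] \<Omega>(2) \<Omega>'(2) \<Omega>Y by (metis comp_apply)
  then show ?thesis
    using iso_cohomologous[OF T T'' X] by (cases W'') blast
qed

lemma equiv_limit_rel:
  fixes g :: "'s set \<Rightarrow> 'i"
  assumes g: "inj_on g {U. openin (unit_top S) U}"
  shows "equiv (local_classes S :: ('i, 's) local_class set) (limit_rel S)"
proof (rule equivI)
  let ?R = "limit_rel S :: (('i, 's) local_class \<times> ('i, 's) local_class) set"
  show "?R \<subseteq> local_classes S \<times> local_classes S"
    by (auto simp: limit_rel_def)
  show "refl_on (local_classes S) ?R"
  proof (rule refl_onI)
    fix a :: "('i, 's) local_class" assume a: "a \<in> local_classes S"
    obtain I U c where a': "a = ((I, U), c)"
      by (metis surj_pair)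
    have "refines_via (I, U) id (I, U)"
      by (simp add: refines_via_def)
    moreover have "open_cover S (I, U)"
      using a by (simp add: a' local_classes_def)
    ultimately show "(a, a) \<in> ?R"
      using a unfolding limit_rel_def a' by blast
  qed
  show "sym ?R"
    unfolding limit_rel_def by (rule symI) (force elim: sym)
  show "trans ?R"
  proof (rule transI)
    fix a b c assume ab: "(a, b) \<in> ?R" and bc: "(b, c) \<in> ?R"
    then have "a \<in> local_classes S" "b \<in> local_classes S" "c \<in> local_classes S"
      by (auto simp: limit_rel_def)
    then obtain I U \<gamma> J V \<eta> L Z \<zeta> where
      a: "a = ((I, U), boundaries S (I, U) #>\<^bsub>cocycles S (I, U)\<^esub> \<gamma>)"
        "open_cover S (I, U)" "\<gamma> \<in> carrier (cocycles S (I, U))" and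
      b: "b = ((J, V), boundaries S (J, V) #>\<^bsub>cocycles S (J, V)\<^esub> \<eta>)"
        "open_cover S (J, V)" "\<eta> \<in> carrier (cocycles S (J, V))" and
      c: "c = ((L, Z), boundaries S (L, Z) #>\<^bsub>cocycles S (L, Z)\<^esub> \<zeta>)"
        "open_cover S (L, Z)" "\<zeta> \<in> carrier (cocycles S (L, Z))"
      unfolding local_classes_iff by blast
    show "(a, c) \<in> ?R"
      using cohomologous_trans[OF g a(2,3) b(2,3) c(2,3)] ab bc
      unfolding a(1) b(1) c(1) limit_rel_iff[OF a(2,3) b(2,3)] limit_rel_iff[OF b(2,3) c(2,3)]
        limit_rel_iff[OF a(2,3) c(2,3)] by blast
  qed
qed

lemma cocycle_class_eq_iff:
  fixes g :: "'s set \<Rightarrow> 'i" and I J :: "'i set"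
  assumes g: "inj_on g {U. openin (unit_top S) U}"
    and U: "open_cover S (I, U)" "\<gamma> \<in> carrier (cocycles S (I, U))"
    and V: "open_cover S (J, V)" "\<eta> \<in> carrier (cocycles S (J, V))"
  shows "cocycle_class S (I, U) \<gamma> = cocycle_class S (J, V) \<eta> \<longleftrightarrow>
    cohomologous (I, U) \<gamma> (J, V) \<eta>"
proof -
  have "((I, U), boundaries S (I, U) #>\<^bsub>cocycles S (I, U)\<^esub> \<gamma>) \<in> local_classes S"
    "((J, V), boundaries S (J, V) #>\<^bsub>cocycles S (J, V)\<^esub> \<eta>) \<in> local_classes S"
    using U V unfolding local_classes_iff by blast+
  then show ?thesis
    unfolding cocycle_class_def limit_rel_iff[OF U V, symmetric]
    by (rule eq_equiv_class_iff[OF equiv_limit_rel[OF g]])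
qed

lemma carrier_sheaf_H1:
  "carrier (sheaf_H1 S) =
    {cocycle_class S U \<gamma> | U \<gamma>. open_cover S U \<and> \<gamma> \<in> carrier (cocycles S U)}"
proof -
  have "local_classes S = (\<lambda>(U, \<gamma>). (U, boundaries S U #>\<^bsub>cocycles S U\<^esub> \<gamma>)) `
      {(U, \<gamma>). open_cover S U \<and> \<gamma> \<in> carrier (cocycles S U)}"
    by (auto simp: local_classes_def cech_H1_def carrier_FactGroup)
  then have "carrier (sheaf_H1 S) = (\<lambda>b. limit_rel S `` {b}) `
      (\<lambda>(U, \<gamma>). (U, boundaries S U #>\<^bsub>cocycles S U\<^esub> \<gamma>)) `
      {(U, \<gamma>). open_cover S U \<and> \<gamma> \<in> carrier (cocycles S U)}"
    by (auto simp: sheaf_H1_def quotient_def)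
  also have "\<dots> = (\<lambda>(U, \<gamma>). cocycle_class S U \<gamma>) `
      {(U, \<gamma>). open_cover S U \<and> \<gamma> \<in> carrier (cocycles S U)}"
    unfolding image_image cocycle_class_def by (intro image_cong refl) (simp add: case_prod_beta)
  finally show ?thesis
    by auto blast
qed

text \<open>For the identity map ratio preservation is visibly symmetric, and it composes.
  Equivalence of trivializations inherits both properties through this criterion.\<close>

lemma equiv_triv_iff:
  fixes g :: "'s set \<Rightarrow> 'i" and I J :: "'i set"
  assumes g: "inj_on g {U. openin (unit_top S) U}" and X: "lch_space_over S X q"
    and T: "is_trivialization S X q ((I, U), \<phi>, \<gamma>)"
    and T': "is_trivialization S X q ((J, V), \<psi>, \<eta>)"
  shows "equiv_triv S X q ((I, U), \<phi>, \<gamma>) ((J, V), \<psi>, \<eta>) \<longleftrightarrow>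
    preserves_ratios X q ((I, U), \<phi>, \<gamma>) ((J, V), \<psi>, \<eta>) id"
  unfolding equiv_triv_def
proof
  assume "\<exists>W \<rho> \<sigma> \<beta>. is_iso S (X, q, (I, U), \<phi>, \<gamma>) (X, q, (J, V), \<psi>, \<eta>) (W, \<rho>, \<sigma>, id, \<beta>)"
  then show "preserves_ratios X q ((I, U), \<phi>, \<gamma>) ((J, V), \<psi>, \<eta>) id"
    using iso_preserves_ratios[OF T T' X] by (metis surj_pair)
qed (use preserves_ratios_iso[OF g T T', of id] in auto)

text \<open>A principal bundle carries many cocycles, one for each trivialization in its maximal
  family. One is chosen, and \<open>char_class_eq\<close> makes the choice immaterial.\<close>

definition char_class :: "('i, 'x, 's) pbundle \<Rightarrow> ('i, 's) local_class set" where
  "char_class P = (let (U, \<phi>, \<gamma>) = SOME T. T \<in> btrivs P in cocycle_class S U \<gamma>)"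

lemma principal_bundleD:
  assumes "principal_bundle S P"
  shows "lch_space_over S (btop P) (bproj P)"
    and "\<exists>T. T \<in> btrivs P"
    and "T \<in> btrivs P \<Longrightarrow> is_trivialization S (btop P) (bproj P) T"
    and "T \<in> btrivs P \<Longrightarrow> T' \<in> btrivs P \<Longrightarrow> equiv_triv S (btop P) (bproj P) T T'"
  using assms by (auto simp: principal_bundle_def compatible_trivs_def)

lemma iso_iff_cocycle_class_eq:
  fixes g :: "'s set \<Rightarrow> 'i" and U V :: "('i, 's) cover"
  assumes g: "inj_on g {U. openin (unit_top S) U}"
    and X: "lch_space_over S X q" and Y: "lch_space_over S Y r"
    and T: "is_trivialization S X q (U, \<phi>, \<gamma>)" and T': "is_trivialization S Y r (V, \<psi>, \<eta>)"
  shows "(\<exists>\<Xi>. is_iso S (X, q, U, \<phi>, \<gamma>) (Y, r, V, \<psi>, \<eta>) \<Xi>) \<longleftrightarrow>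
    cocycle_class S U \<gamma> = cocycle_class S V \<eta>"
proof -
  obtain I U' J V' where UV: "U = (I, U')" "V = (J, V')"
    by fastforce
  note T = T[unfolded UV] and T' = T'[unfolded UV]
  have "(\<exists>\<Xi>. is_iso S (X, q, (I, U'), \<phi>, \<gamma>) (Y, r, (J, V'), \<psi>, \<eta>) \<Xi>) \<longleftrightarrow>
      cohomologous (I, U') \<gamma> (J, V') \<eta>"
    using iso_cohomologous[OF T T' X] cohomologous_iso[OF T T' X Y] by (metis surj_pair)
  then show ?thesis
    unfolding UV cocycle_class_eq_iff[OF g triv_cover[OF T] triv_cocycle[OF T] triv_cover[OF T']
        triv_cocycle[OF T']] .
qed

text \<open>Two trivializations of one bundle are equivalent, so the identity is an isomorphism
  between them and their cocycles have the same class.\<close>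

lemma char_class_eq:
  fixes g :: "'s set \<Rightarrow> 'i" and P :: "('i, 'x, 's) pbundle"
  assumes g: "inj_on g {U. openin (unit_top S) U}"
    and P: "principal_bundle S P" and T: "(U, \<phi>, \<gamma>) \<in> btrivs P"
  shows "char_class P = cocycle_class S U \<gamma>"
proof -
  note P = principal_bundleD[OF P]
  obtain V \<psi> \<eta> where eq: "(SOME T. T \<in> btrivs P) = (V, \<psi>, \<eta>)"
    by (metis surj_pair)
  then have T': "(V, \<psi>, \<eta>) \<in> btrivs P"
    using someI_ex[OF P(2)] by simp
  have "cocycle_class S V \<eta> = cocycle_class S U \<gamma>"
    using P(4)[OF T' T] iso_iff_cocycle_class_eq[OF g P(1,1) P(3)[OF T'] P(3)[OF T]]
    by (auto simp: equiv_triv_def)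
  then show ?thesis
    by (simp add: char_class_def eq)
qed

text \<open>An isomorphism is sought for some pair of trivializations, but the criterion by classes
  gives the same answer for every pair; it remains only that both families are nonempty.\<close>

lemma isomorphic_bundles_iff:
  fixes g :: "'s set \<Rightarrow> 'i" and P :: "('i, 'x, 's) pbundle" and Q :: "('i, 'y, 's) pbundle"
  assumes g: "inj_on g {U. openin (unit_top S) U}"
    and P: "principal_bundle S P" and Q: "principal_bundle S Q"
  shows "isomorphic_bundles S P Q \<longleftrightarrow> char_class P = char_class Q"
proof -
  note P' = principal_bundleD[OF P] and Q' = principal_bundleD[OF Q]
  have "(\<exists>\<Xi>. is_iso S (btop P, bproj P, T) (btop Q, bproj Q, T') \<Xi>) \<longleftrightarrow>
      char_class P = char_class Q" if "T \<in> btrivs P" "T' \<in> btrivs Q" for T T'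
  proof -
    obtain U \<phi> \<gamma> V \<psi> \<eta> where "T = (U, \<phi>, \<gamma>)" "T' = (V, \<psi>, \<eta>)"
      by (metis surj_pair)
    then show ?thesis
      using iso_iff_cocycle_class_eq[OF g P'(1) Q'(1) P'(3) Q'(3)] that
        char_class_eq[OF g P] char_class_eq[OF g Q] by simp
  qed
  then show ?thesis
    unfolding isomorphic_bundles_def using P'(2) Q'(2) by blast
qed

lemma char_class_in_sheaf_H1:
  fixes g :: "'s set \<Rightarrow> 'i" and P :: "('i, 'x, 's) pbundle"
  assumes g: "inj_on g {U. openin (unit_top S) U}" and P: "principal_bundle S P"
  shows "char_class P \<in> carrier (sheaf_H1 S)"
proof -
  obtain I U \<phi> \<gamma> where T: "((I, U), \<phi>, \<gamma>) \<in> btrivs P"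
    using principal_bundleD(2)[OF P] by (metis surj_pair)
  note T' = principal_bundleD(3)[OF P T]
  show ?thesis
    unfolding char_class_eq[OF g P T] carrier_sheaf_H1 using triv_cover[OF T'] triv_cocycle[OF T']
    by blast
qed

text \<open>The maximal family is the equivalence class of the given trivialization. It is maximal
  because a compatible family that includes it contains this trivialization, hence only
  trivializations equivalent to it.\<close>

lemma principal_bundle_of_trivialization:
  fixes g :: "'s set \<Rightarrow> 'i" and X :: "'x topology" and I :: "'i set"
  assumes g: "inj_on g {U. openin (unit_top S) U}" and X: "lch_space_over S X q"
    and T: "is_trivialization S X q ((I, U), \<phi>, \<gamma>)"
  obtains P :: "('i, 'x, 's) pbundle" where "principal_bundle S P" "((I, U), \<phi>, \<gamma>) \<in> btrivs P"
proof -
  let ?T = "((I, U), \<phi>, \<gamma>)"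
  define A where "A = {T'. is_trivialization S X q T' \<and> equiv_triv S X q ?T T'}"
  have sym: "preserves_ratios X q T2 T1 id" if "preserves_ratios X q T1 T2 id"
    for T1 T2 :: "('i, 'x, 's) trivialization"
    using that by (cases T1, cases T2) (auto simp: preserves_ratios_def)
  have "preserves_ratios X q ?T ?T id"
    unfolding preserves_ratios_def prod.case id_apply by (intro ballI impI triv_ratio[OF T]) simp_all
  then have TA: "?T \<in> A"
    using T equiv_triv_iff[OF g X T T] by (simp add: A_def)
  have "equiv_triv S X q T1 T2" if "T1 \<in> A" "T2 \<in> A" for T1 T2
  proof -
    obtain I1 U1 \<phi>1 \<gamma>1 I2 U2 \<phi>2 \<gamma>2 where eq: "T1 = ((I1, U1), \<phi>1, \<gamma>1)" "T2 = ((I2, U2), \<phi>2, \<gamma>2)"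
      by (metis surj_pair)
    have T1: "is_trivialization S X q ((I1, U1), \<phi>1, \<gamma>1)"
      and T2: "is_trivialization S X q ((I2, U2), \<phi>2, \<gamma>2)"
      using that by (auto simp: A_def eq)
    have 1: "preserves_ratios X q T1 ?T id" and 2: "preserves_ratios X q ?T T2 id"
      using that equiv_triv_iff[OF g X T T1] equiv_triv_iff[OF g X T T2] sym
      by (auto simp: A_def eq)
    have "preserves_ratios X q T1 T2 (id \<circ> id)"
      using 1 2 unfolding eq by (intro preserves_ratios_compose[OF T X]) auto
    then show ?thesis
      using equiv_triv_iff[OF g X T1 T2] by (simp add: eq)
  qed
  then have compat: "compatible_trivs S X q A"
    by (auto simp: compatible_trivs_def A_def)
  have "principal_bundle S \<lparr>btop = X, bproj = q, btrivs = A\<rparr>"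
    unfolding principal_bundle_def
  proof (intro conjI allI impI)
    fix B assume B: "compatible_trivs S (btop \<lparr>btop = X, bproj = q, btrivs = A\<rparr>)
        (bproj \<lparr>btop = X, bproj = q, btrivs = A\<rparr>) B \<and>
      btrivs \<lparr>btop = X, bproj = q, btrivs = A\<rparr> \<subseteq> B"
    then have "B \<subseteq> A"
      using TA by (auto simp: compatible_trivs_def A_def)
    then show "B = btrivs \<lparr>btop = X, bproj = q, btrivs = A\<rparr>"
      using B by auto
  qed (use X TA compat in auto)
  then show thesis
    using that TA by fastforce
qed

lemma char_class_surj:
  fixes g :: "'s set \<Rightarrow> 'i" and e :: "'s \<Rightarrow> 'x" and a :: "('i, 's) local_class set"
  assumes g: "inj_on g {U. openin (unit_top S) U}" and e: "inj_on e (topspace (gtop S))"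
    and a: "a \<in> carrier (sheaf_H1 S)"
  obtains P :: "('i, 'x, 's) pbundle" where "principal_bundle S P" "char_class P = a"
proof -
  obtain I U \<gamma> where a': "a = cocycle_class S (I, U) \<gamma>" "open_cover S (I, U)"
    "\<gamma> \<in> carrier (cocycles S (I, U))"
    using a unfolding carrier_sheaf_H1 by auto
  obtain X :: "'x topology" and q \<phi>
    where X: "lch_space_over S X q" and T: "is_trivialization S X q ((I, U), \<phi>, \<gamma>)"
    using cocycle_realized[OF e a'(2,3)] by blast
  obtain P :: "('i, 'x, 's) pbundle"
    where P: "principal_bundle S P" "((I, U), \<phi>, \<gamma>) \<in> btrivs P"
    using principal_bundle_of_trivialization[OF g X T] by blast
  then show thesis
    using that char_class_eq[OF g P] a'(1) by blast
qed

end

theorem theorem1p6: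
  fixes S :: "'s groupoid" and e :: "'s \<Rightarrow> 'x" and g :: "'s set \<Rightarrow> 'i"
  assumes "abelian_bundle S" and "second_countable (gtop S)"
    and "inj_on e (topspace (gtop S))" and "inj_on g {U. openin (unit_top S) U}"
  shows "\<exists>\<Phi> :: ('i, 'x, 's) pbundle set \<Rightarrow> ('i, 's) local_class set.
    bij_betw \<Phi> (bundle_classes S) (carrier (sheaf_H1 S)) \<and>
    (\<forall>P. principal_bundle S P \<longrightarrow>
      (\<forall>(U, \<phi>, \<gamma>) \<in> btrivs P.
        \<gamma> \<in> carrier (cocycles S U) \<and>
        \<Phi> (bundle_iso_rel S `` {P}) = cocycle_class S U \<gamma>))"
proof -
  interpret ab_bundle S
    using assms(1) by unfold_locales
  note g = assms(4)
  let ?B = "{P :: ('i, 'x, 's) pbundle. principal_bundle S P}"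
  define \<Phi> :: "('i, 'x, 's) pbundle set \<Rightarrow> ('i, 's) local_class set"
    where "\<Phi> C = char_class (SOME P. P \<in> C)" for C
  \<comment> \<open>Isomorphism classes are exactly the level sets of \<open>char_class\<close>.
    This yields both the independence of \<open>\<Phi>\<close> from the representative and its
    injectivity.\<close>
  have cls: "bundle_iso_rel S `` {P} = {Q \<in> ?B. char_class Q = char_class P}" if "P \<in> ?B" for P
    using that isomorphic_bundles_iff[OF g] by (auto simp: bundle_iso_rel_def)
  have \<Phi>: "\<Phi> (bundle_iso_rel S `` {P}) = char_class P" if "P \<in> ?B" for P
  proof -
    have "P \<in> bundle_iso_rel S `` {P}"
      using that cls by auto
    then have "(SOME Q. Q \<in> bundle_iso_rel S `` {P}) \<in> bundle_iso_rel S `` {P}"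
      by (rule someI)
    then show ?thesis
      unfolding \<Phi>_def cls[OF that] by simp
  qed
  have classes: "bundle_classes S = (\<lambda>P. bundle_iso_rel S `` {P}) ` ?B"
    by (auto simp: bundle_classes_def quotient_def)
  have "bij_betw \<Phi> (bundle_classes S) (carrier (sheaf_H1 S))"
    unfolding bij_betw_def
  proof
    show "inj_on \<Phi> (bundle_classes S)"
    proof (rule inj_onI)
      fix C C' assume "C \<in> bundle_classes S" "C' \<in> bundle_classes S" and eq: "\<Phi> C = \<Phi> C'"
      then obtain P P' where P: "P \<in> ?B" "C = bundle_iso_rel S `` {P}"
        and P': "P' \<in> ?B" "C' = bundle_iso_rel S `` {P'}"
        unfolding classes by blast
      have "char_class P = char_class P'"
        using eq \<Phi>[OF P(1)] \<Phi>[OF P'(1)] P(2) P'(2) by simp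
      then show "C = C'"
        unfolding P(2) P'(2) cls[OF P(1)] cls[OF P'(1)] by simp
    qed
    have "\<Phi> ` bundle_classes S = char_class ` ?B"
      unfolding classes image_image by (intro image_cong refl \<Phi>)
    also have "\<dots> = carrier (sheaf_H1 S)"
    proof
      show "char_class ` ?B \<subseteq> carrier (sheaf_H1 S)"
        using char_class_in_sheaf_H1[OF g] by blast
      show "carrier (sheaf_H1 S) \<subseteq> char_class ` ?B"
      proof
        fix a :: "('i, 's) local_class set" assume "a \<in> carrier (sheaf_H1 S)"
        then obtain P :: "('i, 'x, 's) pbundle" where "principal_bundle S P" "char_class P = a"
          using char_class_surj[OF g assms(3)] by blast
        then show "a \<in> char_class ` ?B"
          by blast
      qed
    qed
    finally show "\<Phi> ` bundle_classes S = carrier (sheaf_H1 S)" .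
  qed
  moreover have "\<gamma> \<in> carrier (cocycles S U) \<and>
      \<Phi> (bundle_iso_rel S `` {P}) = cocycle_class S U \<gamma>"
    if P: "principal_bundle S P" and T: "(U, \<phi>, \<gamma>) \<in> btrivs P" for P U \<phi> \<gamma>
  proof
    show "\<gamma> \<in> carrier (cocycles S U)"
      using principal_bundleD(3)[OF P T] triv_cocycle by (metis surj_pair)
    show "\<Phi> (bundle_iso_rel S `` {P}) = cocycle_class S U \<gamma>"
      using \<Phi> P char_class_eq[OF g P T] by simp
  qed
  ultimately show ?thesis
    by (intro exI[of _ \<Phi>] conjI allI impI ballI) auto
qed

end
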